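(* Let $(\mathfrak{L},\cdot)$ be a (finite-dimensional, real) symmetric Leibniz algebra, with underlying Lie algebra $(\mathfrak{L},[\,,\,])$, where $[u,v]=\tfrac12(u\cdot v-v\cdot u)$. Let $G$ be the connected simply connected Lie group whose Lie algebra is $(\mathfrak{L},[\,,\,])$, and define the binary operation $$h\rhd g := g^{-1}hg\,\chi(h,g)\qquad (h,g\in G),$$ where $\chi:G\times G\to G$ is the map constructed from $(\mathfrak{L},\cdot)$ in the context. Then $(G,\rhd)$ is a pointed Lie rack (with distinguished element the identity $1$ of $G$), and the right Leibniz algebra associated to it on $T_1G=\mathfrak{L}$ is exactly $(\mathfrak{L},\cdot)$.
   Context: **Leibniz algebras.** An algebra $(\mathfrak{L},\cdot)$ (a vector space with a bilinear product) is a left Leibniz algebra if $u\cdot(v\cdot w)=(u\cdot v)\cdot w+v\cdot(u\cdot w)$ for all $u,v,w$; it is a right Leibniz algebra if $(v\cdot w)\cdot u=(v\cdot u)\cdot w+v\cdot(w\cdot u)$ for all $u,v,w$; it is a symmetric Leibniz algebra if it is both. Write $[u,v]=\frac12(u\cdot v-v\cdot u)$ and $\omega(u,v)=\frac12(u\cdot v+v\cdot u)$, so $u\cdot v=[u,v]+\omega(u,v)$. It is known that $(\mathfrak{L},\cdot)$ is symmetric Leibniz if and only if $(\mathfrak{L},[\,,\,])$ is a Lie algebra, $\omega$ takes values in the center $Z(\mathfrak{L})$ of this Lie algebra, and $\omega([u,v],w)=\omega(\omega(u,v),w)=0$ for all $u,v,w\in\mathfrak{L}$. **Construction of $\chi$.**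 Let $\mathfrak{L}\cdot\mathfrak{L}=\mathrm{span}\{u\cdot v : u,v\in\mathfrak{L}\}$, $\mathfrak{a}=\mathfrak{L}/(\mathfrak{L}\cdot\mathfrak{L})$, and let $q:\mathfrak{L}\to\mathfrak{a}$ be the quotient map. Define the bilinear map $\beta:\mathfrak{a}\times\mathfrak{a}\to\mathfrak{L}$ by $\beta(q(u),q(v))=\omega(u,v)$ (well defined by the identities above). The map $q$ is a Lie algebra homomorphism when $\mathfrak{a}$ is regarded as an abelian Lie algebra. With $G$ the connected simply connected Lie group with Lie algebra $(\mathfrak{L},[\,,\,])$ and exponential map $\exp:\mathfrak{L}\to G$, let $\kappa:G\to\mathfrak{a}$ be the homomorphism of Lie groups ($\mathfrak{a}$ being the additive vector group) with $d_e\kappa=q$. Put $\chi(h,g)=\exp(\beta(\kappa(h),\kappa(g)))$ for $h,g\in G$. **Racks.** A rack is a non-empty set $X$ with a binary operation $\rhd$ such that each map $\mathrm{R}_x:X\to X$, $y\mapsto y\rhd x$, is a bijection and $(x\rhd y)\rhd z=(x\rhd z)\rhd(y\rhd z)$ for all $x,y,z$. It is pointed if there is a distinguished element $1\in X$ with $x\rhd 1=x$ and $1\rhd x=1$ for all $x\in X$. A Lie rack is a smooth manifold with a rack structure such that $\rhd$ is smooth and every $\mathrm{R}_x$ is a diffeomorphism. **Right Leibniz algebra associated to a pointed Lie rack $(X,1)$.** For $x\in X$ one has $\mathrm{R}_x(1)=1$; put $\mathrm{Ad}_x=T_1\mathrm{R}_x:T_1X\to T_1X$. The product on $T_1X$ is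 $u\cdot v=\frac{d}{dt}\big|_{t=0}\mathrm{Ad}_{c(t)}(u)$, where $c:(-\epsilon,\epsilon)\to X$ is a smooth path with $c(0)=1$ and $c'(0)=v$. It is known that this makes $T_1X$ a right Leibniz algebra. *)

theory Defs
  imports "HOL-Analysis.Analysis" "HOL-Algebra.Group"
begin

section \<open>Smooth manifolds\<close>

text \<open>
  Manifolds are modelled on a finite-dimensional normed space \<open>'e\<close> rather than on a
  \<open>euclidean_space\<close>, because the latter class excludes dimension zero. The Hausdorff and
  second-countability axioms are expressed by the type classes of the space of points.
\<close>

definition finite_dim :: "'e::real_vector itself \<Rightarrow> bool" where
  "finite_dim _ \<longleftrightarrow> (\<exists>B :: 'e set. finite B \<and> span B = UNIV)"

text \<open>On open subsets of a finite-dimensional space, the following is the class of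
  \<open>k\<close> times continuously differentiable functions: all iterated directional derivatives of
  order at most \<open>k\<close> exist and are continuous.\<close>

primrec k_smooth_on ::
    "nat \<Rightarrow> 'a::real_normed_vector set \<Rightarrow> ('a \<Rightarrow> 'b::real_normed_vector) \<Rightarrow> bool" where
  "k_smooth_on 0 S f \<longleftrightarrow> continuous_on S f"
| "k_smooth_on (Suc k) S f \<longleftrightarrow>
     (\<forall>x\<in>S. f differentiable (at x)) \<and>
     (\<forall>v. k_smooth_on k S (\<lambda>x. frechet_derivative f (at x) v))"

definition smooth_on ::
    "'a::real_normed_vector set \<Rightarrow> ('a \<Rightarrow> 'b::real_normed_vector) \<Rightarrow> bool" where
  "smooth_on S f \<longleftrightarrow> (\<forall>k. k_smooth_on k S f)"

type_synonym ('m, 'e) chart = "'m set \<times> ('m \<Rightarrow> 'e)"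

definition is_chart :: "('m::topological_space, 'e::real_normed_vector) chart \<Rightarrow> bool" where
  "is_chart c \<longleftrightarrow> open (fst c) \<and> open (snd c ` fst c) \<and>
     (\<exists>g. homeomorphism (fst c) (snd c ` fst c) (snd c) g)"

abbreviation chart_inv :: "('m, 'e) chart \<Rightarrow> 'e \<Rightarrow> 'm" where
  "chart_inv c \<equiv> inv_into (fst c) (snd c)"

definition smooth_manifold ::
    "('m::{t2_space, second_countable_topology}, 'e::real_normed_vector) chart set \<Rightarrow> bool" where
  "smooth_manifold A \<longleftrightarrow>
     finite_dim TYPE('e) \<and> (\<forall>c\<in>A. is_chart c) \<and> (\<Union>c\<in>A. fst c) = UNIV \<and>
     (\<forall>c\<in>A. \<forall>d\<in>A. smooth_on (snd c ` (fst c \<inter> fst d)) (snd d \<circ> chart_inv c))"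

definition vs_atlas :: "('a::real_normed_vector, 'a) chart set" where
  "vs_atlas = {(UNIV, \<lambda>x. x)}"

definition prod_atlas ::
    "('m, 'e) chart set \<Rightarrow> ('n, 'f) chart set \<Rightarrow> ('m \<times> 'n, 'e \<times> 'f) chart set" where
  "prod_atlas A B = {(fst c \<times> fst d, map_prod (snd c) (snd d)) | c d. c \<in> A \<and> d \<in> B}"

text \<open>The set \<open>S\<close> is meant to be open.\<close>

definition smooth_map_on ::
    "('m::topological_space, 'e::real_normed_vector) chart set \<Rightarrow>
     ('n::topological_space, 'f::real_normed_vector) chart set \<Rightarrow> 'm set \<Rightarrow> ('m \<Rightarrow> 'n) \<Rightarrow> bool" where
  "smooth_map_on A B S f \<longleftrightarrow> continuous_on S f \<and>
     (\<forall>c\<in>A. \<forall>d\<in>B. smooth_on (snd c ` (S \<inter> fst c \<inter> f -` fst d)) (snd d \<circ> f \<circ> chart_inv c))"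

abbreviation smooth_map ::
    "('m::topological_space, 'e::real_normed_vector) chart set \<Rightarrow>
     ('n::topological_space, 'f::real_normed_vector) chart set \<Rightarrow> ('m \<Rightarrow> 'n) \<Rightarrow> bool" where
  "smooth_map A B f \<equiv> smooth_map_on A B UNIV f"

definition diffeo ::
    "('m::topological_space, 'e::real_normed_vector) chart set \<Rightarrow>
     ('n::topological_space, 'f::real_normed_vector) chart set \<Rightarrow> ('m \<Rightarrow> 'n) \<Rightarrow> bool" where
  "diffeo A B f \<longleftrightarrow> bij f \<and> smooth_map A B f \<and> smooth_map B A (inv_into UNIV f)"

section \<open>Tangent vectors\<close>

text \<open>
  A tangent vector at \<open>p\<close> is the family of its coordinate vectors in all charts around \<open>p\<close>,
  any two of them being related by the derivative of the change of charts. The value at a chart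
  not around \<open>p\<close> carries no information and is normalized to zero. The vector space operations
  are those of functions with values in \<open>'e\<close>.
\<close>

type_synonym ('m, 'e) tvec = "('m, 'e) chart \<Rightarrow> 'e"

definition charts_at :: "('m, 'e) chart set \<Rightarrow> 'm \<Rightarrow> ('m, 'e) chart set" where
  "charts_at A p = {c \<in> A. p \<in> fst c}"

definition tangent_space ::
    "('m, 'e::real_normed_vector) chart set \<Rightarrow> 'm \<Rightarrow> ('m, 'e) tvec set" where
  "tangent_space A p = {\<xi>.
     (\<forall>c\<in>charts_at A p. \<forall>d\<in>charts_at A p.
        \<xi> d = frechet_derivative (snd d \<circ> chart_inv c) (at (snd c p)) (\<xi> c)) \<and>
     (\<forall>c. c \<notin> charts_at A p \<longrightarrow> \<xi> c = 0)}"

text \<open>The coordinates of the image may be computed from any chart around \<open>p\<close>.\<close>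

definition tangent_map ::
    "('m, 'e::real_normed_vector) chart set \<Rightarrow> ('n, 'f::real_normed_vector) chart set \<Rightarrow>
     ('m \<Rightarrow> 'n) \<Rightarrow> 'm \<Rightarrow> ('m, 'e) tvec \<Rightarrow> ('n, 'f) tvec" where
  "tangent_map A B f p \<xi> = (\<lambda>d. if d \<in> charts_at B (f p)
     then let c = (SOME c. c \<in> charts_at A p)
          in frechet_derivative (snd d \<circ> f \<circ> chart_inv c) (at (snd c p)) (\<xi> c)
     else 0)"

definition velocity ::
    "('m, 'e::real_normed_vector) chart set \<Rightarrow> (real \<Rightarrow> 'm) \<Rightarrow> real \<Rightarrow> ('m, 'e) tvec" where
  "velocity A \<gamma> t = (\<lambda>c. if c \<in> charts_at A (\<gamma> t)
     then vector_derivative (snd c \<circ> \<gamma>) (at t) else 0)"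

section \<open>Lie groups\<close>

definition lie_group ::
    "('g::{t2_space, second_countable_topology}, 'e::real_normed_vector) chart set \<Rightarrow>
     'g monoid \<Rightarrow> bool" where
  "lie_group A G \<longleftrightarrow> smooth_manifold A \<and> group G \<and> carrier G = UNIV \<and>
     smooth_map (prod_atlas A A) A (\<lambda>(x, y). x \<otimes>\<^bsub>G\<^esub> y) \<and>
     smooth_map A A (\<lambda>x. inv\<^bsub>G\<^esub> x)"

definition left_inv_field ::
    "('g, 'e::real_normed_vector) chart set \<Rightarrow> 'g monoid \<Rightarrow> ('g, 'e) tvec \<Rightarrow> 'g \<Rightarrow> ('g, 'e) tvec" where
  "left_inv_field A G \<xi> g = tangent_map A A (\<lambda>x. g \<otimes>\<^bsub>G\<^esub> x) \<one>\<^bsub>G\<^esub> \<xi>"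

text \<open>In a chart, \<open>[X, Y] = DY(X) - DX(Y)\<close>; this is the sign convention in which vector fields
  act as derivations with \<open>[X, Y] f = X (Y f) - Y (X f)\<close>.\<close>

definition field_bracket ::
    "('m, 'e::real_normed_vector) chart set \<Rightarrow> ('m \<Rightarrow> ('m, 'e) tvec) \<Rightarrow> ('m \<Rightarrow> ('m, 'e) tvec) \<Rightarrow>
     'm \<Rightarrow> ('m, 'e) tvec" where
  "field_bracket A X Y p = (\<lambda>c. if c \<in> charts_at A p
     then frechet_derivative (\<lambda>x. Y (chart_inv c x) c) (at (snd c p)) (X p c)
        - frechet_derivative (\<lambda>x. X (chart_inv c x) c) (at (snd c p)) (Y p c)
     else 0)"

definition lie_bracket ::
    "('g, 'e::real_normed_vector) chart set \<Rightarrow> 'g monoid \<Rightarrow>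
     ('g, 'e) tvec \<Rightarrow> ('g, 'e) tvec \<Rightarrow> ('g, 'e) tvec" where
  "lie_bracket A G \<xi> \<eta> = field_bracket A (left_inv_field A G \<xi>) (left_inv_field A G \<eta>) \<one>\<^bsub>G\<^esub>"

text \<open>\<open>\<iota>\<close> identifies the Lie algebra \<open>('l, br)\<close> with the Lie algebra of \<open>G\<close>.\<close>

definition lie_algebra_ident ::
    "('g, 'e::real_normed_vector) chart set \<Rightarrow> 'g monoid \<Rightarrow>
     ('l::real_vector \<Rightarrow> 'l \<Rightarrow> 'l) \<Rightarrow> ('l \<Rightarrow> ('g, 'e) tvec) \<Rightarrow> bool" where
  "lie_algebra_ident A G br \<iota> \<longleftrightarrow>
     (\<forall>c. linear (\<lambda>u. \<iota> u c)) \<and> bij_betw \<iota> UNIV (tangent_space A \<one>\<^bsub>G\<^esub>) \<and>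
     (\<forall>u v. \<iota> (br u v) = lie_bracket A G (\<iota> u) (\<iota> v))"

text \<open>The exponential map is the map for which every \<open>t \<mapsto> ex (t v)\<close> is the one-parameter
  subgroup with initial velocity \<open>v\<close>; in particular \<open>ex v\<close> is its value at time 1.\<close>

definition exponential_map ::
    "('g::topological_space, 'e::real_normed_vector) chart set \<Rightarrow> 'g monoid \<Rightarrow>
     ('l::real_vector \<Rightarrow> ('g, 'e) tvec) \<Rightarrow> ('l \<Rightarrow> 'g) \<Rightarrow> bool" where
  "exponential_map A G \<iota> ex \<longleftrightarrow> (\<forall>v. let \<gamma> = (\<lambda>t::real. ex (t *\<^sub>R v)) in
     smooth_map vs_atlas A \<gamma> \<and> (\<forall>s t. \<gamma> (s + t) = \<gamma> s \<otimes>\<^bsub>G\<^esub> \<gamma> t) \<and> velocity A \<gamma> 0 = \<iota> v)"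

text \<open>Lie group homomorphisms into an additive vector group with prescribed differential at
  the identity (the target has a single chart, the identity).\<close>

definition integrates_hom ::
    "('g::topological_space, 'e::real_normed_vector) chart set \<Rightarrow> 'g monoid \<Rightarrow>
     ('l \<Rightarrow> ('g, 'e) tvec) \<Rightarrow> ('l \<Rightarrow> 'q::real_normed_vector) \<Rightarrow> ('g \<Rightarrow> 'q) \<Rightarrow> bool" where
  "integrates_hom A G \<iota> q \<kappa> \<longleftrightarrow>
     smooth_map A vs_atlas \<kappa> \<and> (\<forall>g h. \<kappa> (g \<otimes>\<^bsub>G\<^esub> h) = \<kappa> g + \<kappa> h) \<and>
     (\<forall>u. tangent_map A vs_atlas \<kappa> \<one>\<^bsub>G\<^esub> (\<iota> u) (UNIV, \<lambda>x. x) = q u)"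

section \<open>Symmetric Leibniz algebras\<close>

definition left_leibniz :: "('l::real_vector \<Rightarrow> 'l \<Rightarrow> 'l) \<Rightarrow> bool" where
  "left_leibniz p \<longleftrightarrow> bilinear p \<and> (\<forall>u v w. p u (p v w) = p (p u v) w + p v (p u w))"

definition right_leibniz :: "('l::real_vector \<Rightarrow> 'l \<Rightarrow> 'l) \<Rightarrow> bool" where
  "right_leibniz p \<longleftrightarrow> bilinear p \<and> (\<forall>u v w. p (p v w) u = p (p v u) w + p v (p w u))"

definition symmetric_leibniz :: "('l::real_vector \<Rightarrow> 'l \<Rightarrow> 'l) \<Rightarrow> bool" where
  "symmetric_leibniz p \<longleftrightarrow> left_leibniz p \<and> right_leibniz p"

definition skew_part :: "('l::real_vector \<Rightarrow> 'l \<Rightarrow> 'l) \<Rightarrow> 'l \<Rightarrow> 'l \<Rightarrow> 'l" where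
  "skew_part p u v = (1/2) *\<^sub>R (p u v - p v u)"

definition sym_part :: "('l::real_vector \<Rightarrow> 'l \<Rightarrow> 'l) \<Rightarrow> 'l \<Rightarrow> 'l \<Rightarrow> 'l" where
  "sym_part p u v = (1/2) *\<^sub>R (p u v + p v u)"

text \<open>\<open>q\<close> presents its codomain as the quotient of \<open>'l\<close> by the span of all products.\<close>

definition leibniz_quotient ::
    "('l::real_vector \<Rightarrow> 'l \<Rightarrow> 'l) \<Rightarrow> ('l \<Rightarrow> 'q::real_vector) \<Rightarrow> bool" where
  "leibniz_quotient p q \<longleftrightarrow> linear q \<and> surj q \<and> {u. q u = 0} = span {p u v | u v. True}"

text \<open>The map with \<open>\<beta> (q u) (q v) = \<omega>(u, v)\<close>, where \<open>\<omega>\<close> is the symmetric part of the product;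
  for symmetric Leibniz algebras the choice of preimages is irrelevant.\<close>

definition leibniz_beta ::
    "('l::real_vector \<Rightarrow> 'l \<Rightarrow> 'l) \<Rightarrow> ('l \<Rightarrow> 'q) \<Rightarrow> 'q \<Rightarrow> 'q \<Rightarrow> 'l" where
  "leibniz_beta p q x y = sym_part p (inv_into UNIV q x) (inv_into UNIV q y)"

definition leibniz_chi ::
    "('l::real_vector \<Rightarrow> 'l \<Rightarrow> 'l) \<Rightarrow> ('l \<Rightarrow> 'q) \<Rightarrow> ('g \<Rightarrow> 'q) \<Rightarrow> ('l \<Rightarrow> 'g) \<Rightarrow> 'g \<Rightarrow> 'g \<Rightarrow> 'g" where
  "leibniz_chi p q \<kappa> ex h g = ex (leibniz_beta p q (\<kappa> h) (\<kappa> g))"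

definition leibniz_rack_op ::
    "'g monoid \<Rightarrow> ('l::real_vector \<Rightarrow> 'l \<Rightarrow> 'l) \<Rightarrow> ('l \<Rightarrow> 'q) \<Rightarrow> ('g \<Rightarrow> 'q) \<Rightarrow> ('l \<Rightarrow> 'g) \<Rightarrow>
     'g \<Rightarrow> 'g \<Rightarrow> 'g" where
  "leibniz_rack_op G p q \<kappa> ex h g =
     inv\<^bsub>G\<^esub> g \<otimes>\<^bsub>G\<^esub> h \<otimes>\<^bsub>G\<^esub> g \<otimes>\<^bsub>G\<^esub> leibniz_chi p q \<kappa> ex h g"

section \<open>Pointed Lie racks\<close>

text \<open>The underlying set of a rack is a whole type, hence non-empty.\<close>

definition rack :: "('m \<Rightarrow> 'm \<Rightarrow> 'm) \<Rightarrow> bool" where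
  "rack r \<longleftrightarrow> (\<forall>x. bij (\<lambda>y. r y x)) \<and> (\<forall>x y z. r (r x y) z = r (r x z) (r y z))"

definition pointed_rack :: "('m \<Rightarrow> 'm \<Rightarrow> 'm) \<Rightarrow> 'm \<Rightarrow> bool" where
  "pointed_rack r e \<longleftrightarrow> rack r \<and> (\<forall>x. r x e = x \<and> r e x = e)"

definition lie_rack ::
    "('m::{t2_space, second_countable_topology}, 'e::real_normed_vector) chart set \<Rightarrow>
     ('m \<Rightarrow> 'm \<Rightarrow> 'm) \<Rightarrow> bool" where
  "lie_rack A r \<longleftrightarrow> smooth_manifold A \<and> rack r \<and>
     smooth_map (prod_atlas A A) A (\<lambda>(x, y). r x y) \<and> (\<forall>x. diffeo A A (\<lambda>y. r y x))"

definition pointed_lie_rack ::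
    "('m::{t2_space, second_countable_topology}, 'e::real_normed_vector) chart set \<Rightarrow>
     ('m \<Rightarrow> 'm \<Rightarrow> 'm) \<Rightarrow> 'm \<Rightarrow> bool" where
  "pointed_lie_rack A r e \<longleftrightarrow> lie_rack A r \<and> pointed_rack r e"

definition rack_Ad ::
    "('m, 'e::real_normed_vector) chart set \<Rightarrow> ('m \<Rightarrow> 'm \<Rightarrow> 'm) \<Rightarrow> 'm \<Rightarrow> 'm \<Rightarrow>
     ('m, 'e) tvec \<Rightarrow> ('m, 'e) tvec" where
  "rack_Ad A r e x = tangent_map A A (\<lambda>y. r y x) e"

text \<open>The product of \<open>\<xi>\<close> and \<open>\<eta>\<close> is the derivative at 0 of \<open>t \<mapsto> Ad (c t) \<xi>\<close>, a path in the
  tangent space at \<open>e\<close>, for every smooth path \<open>c\<close> through \<open>e\<close> with velocity \<open>\<eta>\<close>. The derivative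
  is taken chart by chart.\<close>

definition rack_product ::
    "('m::topological_space, 'e::real_normed_vector) chart set \<Rightarrow> ('m \<Rightarrow> 'm \<Rightarrow> 'm) \<Rightarrow> 'm \<Rightarrow>
     ('m, 'e) tvec \<Rightarrow> ('m, 'e) tvec \<Rightarrow> ('m, 'e) tvec" where
  "rack_product A r e \<xi> \<eta> = (THE \<zeta>. \<zeta> \<in> tangent_space A e \<and>
     (\<forall>\<epsilon>>0. \<forall>c. smooth_map_on vs_atlas A {-\<epsilon><..<\<epsilon>} c \<and> c 0 = e \<and> velocity A c 0 = \<eta> \<longrightarrow>
        (\<forall>d\<in>charts_at A e.
           ((\<lambda>t. rack_Ad A r e (c t) \<xi> d) has_vector_derivative \<zeta> d) (at 0))))"

end

theory Submission
  imports Defs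
begin

text \<open>
  The symmetric part \<open>\<beta>\<close> takes values in the center of the Lie algebra. For central \<open>z\<close> the
  derivative of \<open>t \<mapsto> Ad (exp (t z))\<close> vanishes, so conjugation by \<open>exp z\<close> is a homomorphism with
  differential the identity at 1, hence the identity as \<open>G\<close> is connected. The same argument shows
  that \<open>exp\<close> is additive on the center, so \<open>\<chi>\<close> is a central bimultiplicative map killed by
  \<open>\<kappa>\<close>, and it is smooth because it is a finite product of one-parameter subgroups. It follows that
  \<open>(h \<rhd> g) \<rhd> g' = h \<rhd> g g'\<close>, which gives the rack axioms. The differential of \<open>y \<mapsto> y \<rhd> x\<close> at 1
  is \<open>u \<mapsto> Ad (x\<inverse>) u + \<beta> (q u, \<kappa> x)\<close>; differentiating in \<open>x\<close> along \<open>v\<close> gives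
  \<open>[u, v] + \<omega>(u, v) = u \<cdot> v\<close>. No smoothness of \<open>exp\<close> beyond one-parameter subgroups is needed.
\<close>

section \<open>Calculus in finite-dimensional normed spaces\<close>

text \<open>The passage from group to algebra rests on one second derivative. In a chart around the
  identity, multiplication has a mixed second derivative \<open>B2\<close>. The bracket of
  left-invariant fields is \<open>B2 u v - B2 v u\<close>, and the derivative of the adjoint action
  is the same expression only because mixed second derivatives commute. Conjugation sends
  \<open>y\<close> to \<open>inv g \<otimes> y \<otimes> g\<close>, so \<open>Ad\<close> reverses
  products and its derivative along \<open>v\<close>, applied to \<open>u\<close>, is
  \<open>[u, v]\<close> and not \<open>[v, u]\<close>, as the right Leibniz product demands.

  The model space is an abstract normed space with a finite spanning set, so continuity of linear
  maps is itself proved, through bounded coordinate functionals. Rigidity does not come from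
  uniqueness for differential equations: a zero derivative at one point, together with a functional
  equation that transports this point everywhere, gives a zero derivative everywhere and hence a
  constant map on a connected space. Computations take place in a fixed but arbitrary chart
  \<open>d\<close>, because the rack product is tested chart by chart.\<close>

text \<open>For nonzero \<open>k\<close>, division by \<open>k\<close> turns the vector into the
  difference of \<open>b\<close> and a point of \<open>S\<close>. This bounds the coefficient of
  \<open>b\<close> by the norm, the estimate behind both complete spans and bounded
  coordinates.\<close>

lemma infdist_subspace_le:
  fixes S :: "'a::real_normed_vector set"
  assumes "subspace S" "x \<in> S"
  shows "\<bar>k\<bar> * infdist b S \<le> norm (x + k *\<^sub>R b)"
proof (cases "k = 0")
  case False
  have "infdist b S \<le> dist b ((- 1 / k) *\<^sub>R x)"
    using assms by (intro infdist_le subspace_scale)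
  also have "\<dots> = norm ((1 / k) *\<^sub>R (x + k *\<^sub>R b))"
    using False by (simp add: dist_norm scaleR_add_right add.commute)
  also have "\<dots> = norm (x + k *\<^sub>R b) / \<bar>k\<bar>"
    by simp
  finally show ?thesis
    using False by (simp add: field_simps)
qed simp

text \<open>By induction the old span is closed, so a new vector \<open>b\<close> outside it has
  positive distance from it. Hence the coefficients of \<open>b\<close> along a Cauchy sequence are
  Cauchy, and so are the remainders in the old span.\<close>

lemma complete_span_finite:
  fixes B :: "'a::real_normed_vector set"
  assumes "finite B"
  shows "complete (span B)"
  using assms
proof (induction B)
  case empty
  then show ?case by (simp add: compact_imp_complete)
next
  case (insert b B)
  show ?case
  proof (cases "b \<in> span B")
    case True
    then show ?thesis using insert by (simp add: span_redundant)
  next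
    case False
    let ?d = "infdist b (span B)"
    have d: "?d > 0"
      using infdist_pos_not_in_closed[OF complete_imp_closed[OF insert.IH] _ False] span_zero by blast
    show ?thesis
    proof (rule completeI)
      fix f :: "nat \<Rightarrow> 'a"
      assume "\<forall>n. f n \<in> span (insert b B)" and f: "Cauchy f"
      then obtain k where k: "\<And>n. f n - k n *\<^sub>R b \<in> span B"
        unfolding span_breakdown_eq by metis
      have bound: "\<bar>k m - k n\<bar> * ?d \<le> norm (f m - f n)" for m n
      proof -
        have "f m - f n - (k m - k n) *\<^sub>R b \<in> span B"
          using span_diff[OF k k, of m n] by (simp add: algebra_simps)
        from infdist_subspace_le[OF subspace_span this, of "k m - k n" b] show ?thesis by simp
      qed
      have "Cauchy k"
      proof (rule metric_CauchyI)
        fix e :: real assume "e > 0"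
        then have "e * ?d > 0" using d by simp
        from metric_CauchyD[OF f this] obtain M where
          M: "\<forall>m\<ge>M. \<forall>n\<ge>M. dist (f m) (f n) < e * ?d" by blast
        have "dist (k m) (k n) < e" if "m \<ge> M" "n \<ge> M" for m n
        proof -
          have "\<bar>k m - k n\<bar> * ?d < e * ?d"
            using bound[of m n] M that by (auto simp: dist_norm intro: le_less_trans)
          then show ?thesis using d by (simp add: dist_norm)
        qed
        then show "\<exists>M. \<forall>m\<ge>M. \<forall>n\<ge>M. dist (k m) (k n) < e" by blast
      qed
      then obtain l where l: "k \<longlonglongrightarrow> l"
        using Cauchy_convergent_iff convergent_def by blast
      have "Cauchy (\<lambda>n. f n - k n *\<^sub>R b)" (is "Cauchy ?x")
      proof (rule metric_CauchyI)
        fix e :: real assume "e > 0"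
        \<comment> \<open>A bound for the projection onto \<open>span B\<close> along
          \<open>b\<close>: the component removed is at most \<open>norm b / ?d\<close> times the
          norm.\<close>
        let ?K = "1 + norm b / ?d"
        have K: "?K > 0" using d by (simp add: add_pos_nonneg)
        have le: "dist (f m - k m *\<^sub>R b) (f n - k n *\<^sub>R b) \<le> norm (f m - f n) * ?K" for m n
        proof -
          have "f m - k m *\<^sub>R b - (f n - k n *\<^sub>R b) = (f m - f n) - (k m - k n) *\<^sub>R b"
            by (simp add: algebra_simps)
          then have "dist (f m - k m *\<^sub>R b) (f n - k n *\<^sub>R b) \<le> norm (f m - f n) + \<bar>k m - k n\<bar> * norm b"
            using norm_triangle_ineq4[of "f m - f n" "(k m - k n) *\<^sub>R b"] unfolding dist_norm
            by (metis norm_scaleR)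
          also have "\<bar>k m - k n\<bar> \<le> norm (f m - f n) / ?d"
            using bound[of m n] d by (simp add: field_simps)
          finally show ?thesis by (simp add: algebra_simps mult_right_mono)
        qed
        have "e / ?K > 0" using K \<open>e > 0\<close> by simp
        from metric_CauchyD[OF f this] obtain M where
          M: "\<forall>m\<ge>M. \<forall>n\<ge>M. dist (f m) (f n) < e / ?K" by blast
        have "dist (f m - k m *\<^sub>R b) (f n - k n *\<^sub>R b) < e" if "m \<ge> M" "n \<ge> M" for m n
        proof -
          have "norm (f m - f n) * ?K < e"
            using M that K by (simp add: dist_norm pos_less_divide_eq)
          then show ?thesis using le[of m n] by linarith
        qed
        then show "\<exists>M. \<forall>m\<ge>M. \<forall>n\<ge>M. dist (f m - k m *\<^sub>R b) (f n - k n *\<^sub>R b) < e" by blast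
      qed
      with k obtain x where x: "x \<in> span B" "(\<lambda>n. f n - k n *\<^sub>R b) \<longlonglongrightarrow> x"
        using completeE[OF insert.IH, of ?x] by blast
      have "(\<lambda>n. (f n - k n *\<^sub>R b) + k n *\<^sub>R b) \<longlonglongrightarrow> x + l *\<^sub>R b"
        by (rule tendsto_add[OF x(2) tendsto_scaleR[OF l tendsto_const]])
      moreover have "x + l *\<^sub>R b \<in> span (insert b B)"
        unfolding span_breakdown_eq using x by (intro exI[of _ l]) simp
      ultimately show "\<exists>l\<in>span (insert b B). f \<longlonglongrightarrow> l" by auto
    qed
  qed
qed

text \<open>The coordinate along a basis vector \<open>b\<close> is at most the norm divided by the
  distance from \<open>b\<close> to the span of the others, positive because that span is closed.
  Outside the basis \<open>\<phi> b\<close> is zero, so boundedness holds for every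
  \<open>b\<close>.\<close>

lemma finite_dim_coordinates:
  assumes "finite_dim TYPE('a::real_normed_vector)"
  obtains B :: "'a::real_normed_vector set" and \<phi> :: "'a \<Rightarrow> 'a \<Rightarrow> real"
  where "finite B" "\<And>b. bounded_linear (\<phi> b)" "\<And>x. x = (\<Sum>b\<in>B. \<phi> b x *\<^sub>R b)"
proof -
  obtain B0 :: "'a set" where B0: "finite B0" "span B0 = UNIV"
    using assms unfolding finite_dim_def by blast
  obtain B where B: "B \<subseteq> B0" "independent B" "B0 \<subseteq> span B"
    using maximal_independent_subset by blast
  have fin: "finite B" using B B0 finite_subset by blast
  have span: "span B = UNIV"
    using B(3) B0(2) span_minimal[OF B(3) subspace_span] by auto
  define \<phi> where "\<phi> b x = representation B x b" for b x
  have sum: "x = (\<Sum>b\<in>B. \<phi> b x *\<^sub>R b)" for x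
    unfolding \<phi>_def by (rule sum_representation_eq[symmetric]) (use B fin span in auto)
  have "bounded_linear (\<phi> b)" for b
  proof (cases "b \<in> B")
    case False
    then have "\<phi> b = (\<lambda>x. 0)"
      unfolding \<phi>_def using representation_ne_zero by blast
    then show ?thesis by simp
  next
    case True
    let ?S = "span (B - {b})"
    let ?d = "infdist b ?S"
    have "b \<notin> ?S" using B(2) True unfolding dependent_def by blast
    then have d: "?d > 0"
      using infdist_pos_not_in_closed[OF complete_imp_closed[OF complete_span_finite]] fin span_zero
      by blast
    show ?thesis
    proof (rule bounded_linear_intro[where K = "1 / ?d"])
      fix x
      have "x = (\<Sum>c\<in>B - {b}. \<phi> c x *\<^sub>R c) + \<phi> b x *\<^sub>R b"
        using sum[of x] sum.remove[OF fin True, of "\<lambda>c. \<phi> c x *\<^sub>R c"] by (simp add: add.commute)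
      moreover have "(\<Sum>c\<in>B - {b}. \<phi> c x *\<^sub>R c) \<in> ?S"
        by (intro span_sum span_scale span_base)
      ultimately have "\<bar>\<phi> b x\<bar> * ?d \<le> norm x"
        using infdist_subspace_le[OF subspace_span] by metis
      then show "norm (\<phi> b x) \<le> norm x * (1 / ?d)"
        using d by (simp add: field_simps)
    qed (use B span in \<open>auto simp: \<phi>_def representation_add representation_scale\<close>)
  qed
  with fin sum show ?thesis using that by blast
qed

lemma linear_finite_dim_imp_bounded_linear:
  fixes f :: "'a::real_normed_vector \<Rightarrow> 'b::real_normed_vector"
  assumes "finite_dim TYPE('a)" "linear f"
  shows "bounded_linear f"
proof -
  obtain B :: "'a set" and \<phi> where B: "finite B" "\<And>b. bounded_linear (\<phi> b :: 'a \<Rightarrow> real)"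
    "\<And>x. x = (\<Sum>b\<in>B. \<phi> b x *\<^sub>R b)"
    using finite_dim_coordinates[OF assms(1)] by blast
  have f_sum: "f = (\<lambda>x. \<Sum>b\<in>B. \<phi> b x *\<^sub>R f b)"
  proof
    show "f x = (\<Sum>b\<in>B. \<phi> b x *\<^sub>R f b)" for x
      by (subst B(3)[of x]) (simp add: linear_sum[OF assms(2)] linear_scale[OF assms(2)])
  qed
  show ?thesis
    by (subst f_sum) (intro bounded_linear_sum bounded_linear_scaleR_const B)
qed

lemma finite_dim_image:
  fixes f :: "'a::real_vector \<Rightarrow> 'b::real_vector"
  assumes "finite_dim TYPE('a)" "linear f" "surj f"
  shows "finite_dim TYPE('b)"
proof -
  obtain B :: "'a set" where "finite B" "span B = UNIV"
    using assms(1) unfolding finite_dim_def by blast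
  then show ?thesis unfolding finite_dim_def
    by (intro exI[of _ "f ` B"]) (use linear_span_image[OF assms(2), of B] assms(3) in auto)
qed

lemma finite_dim_real: "finite_dim TYPE(real)"
proof -
  have "x \<in> span {1}" for x :: real
    using span_scale[OF span_base[OF singletonI], of x "1 :: real"] by (simp del: span_singleton)
  then show ?thesis unfolding finite_dim_def by blast
qed

lemma finite_dim_prod:
  assumes "finite_dim TYPE('a::real_vector)" "finite_dim TYPE('b::real_vector)"
  shows "finite_dim TYPE('a::real_vector \<times> 'b::real_vector)"
proof -
  obtain B :: "'a set" and C :: "'b set" where BC: "finite B" "span B = UNIV" "finite C" "span C = UNIV"
    using assms unfolding finite_dim_def by blast
  let ?i = "\<lambda>x::'a. (x, 0::'b)" and ?j = "\<lambda>y::'b. (0::'a, y)"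
  have lin: "linear ?i" "linear ?j" by (auto intro!: linearI)
  let ?D = "?i ` B \<union> ?j ` C"
  have "(x, y) \<in> span ?D" for x y
  proof -
    have "?i x \<in> span (?i ` B)" "?j y \<in> span (?j ` C)"
      unfolding linear_span_image[OF lin(1)] linear_span_image[OF lin(2)] BC by auto
    then have "?i x \<in> span ?D" "?j y \<in> span ?D"
      by (meson span_mono subsetD Un_upper1 Un_upper2)+
    from span_add[OF this] show ?thesis by simp
  qed
  then show ?thesis unfolding finite_dim_def
    by (intro exI[of _ ?D]) (use BC in auto)
qed

text \<open>Expanding \<open>a y\<close> in a basis leaves finitely many scalar product rules. Thus
  it is enough to differentiate \<open>L\<close> at each fixed vector, without a norm on a space of
  linear maps.\<close>

lemma has_derivative_linear_family:
  fixes L :: "'c::real_normed_vector \<Rightarrow> 'a::real_normed_vector \<Rightarrow> 'b::real_normed_vector"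
  assumes "finite_dim TYPE('a)" "open S" "x \<in> S"
    and L: "\<And>y. y \<in> S \<Longrightarrow> linear (L y)"
    and L': "\<And>w. ((\<lambda>y. L y w) has_derivative L' w) (at x)"
    and a: "(a has_derivative a') (at x)"
  shows "((\<lambda>y. L y (a y)) has_derivative (\<lambda>h. L' (a x) h + L x (a' h))) (at x)"
proof -
  obtain B :: "'a set" and \<phi> where B: "finite B" "\<And>b. bounded_linear (\<phi> b :: 'a \<Rightarrow> real)"
    "\<And>x. x = (\<Sum>b\<in>B. \<phi> b x *\<^sub>R b)"
    using finite_dim_coordinates[OF assms(1)] by blast
  have L_sum: "L y w = (\<Sum>b\<in>B. \<phi> b w *\<^sub>R L y b)" if "y \<in> S" for y w
    by (subst B(3)[of w]) (simp add: linear_sum[OF L[OF that]] linear_scale[OF L[OF that]])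
  have "((\<lambda>y. \<Sum>b\<in>B. \<phi> b w *\<^sub>R L y b) has_derivative (\<lambda>h. \<Sum>b\<in>B. \<phi> b w *\<^sub>R L' b h)) (at x)" for w
    by (intro has_derivative_sum has_derivative_scaleR_right L')
  then have "((\<lambda>y. L y w) has_derivative (\<lambda>h. \<Sum>b\<in>B. \<phi> b w *\<^sub>R L' b h)) (at x)" for w
    by (rule has_derivative_transform_within_open[OF _ assms(2,3)]) (rule L_sum[symmetric])
  \<comment> \<open>Linearity of \<open>L'\<close> in \<open>w\<close> comes from uniqueness of the
    derivative.\<close>
  then have L'_sum: "L' w h = (\<Sum>b\<in>B. \<phi> b w *\<^sub>R L' b h)" for w h
    using has_derivative_unique[OF L'[of w]] by metis
  have "((\<lambda>y. \<Sum>b\<in>B. \<phi> b (a y) *\<^sub>R L y b) has_derivative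
      (\<lambda>h. \<Sum>b\<in>B. \<phi> b (a x) *\<^sub>R L' b h + \<phi> b (a' h) *\<^sub>R L x b)) (at x)"
    by (intro has_derivative_sum has_derivative_scaleR L' bounded_linear.has_derivative[OF B(2)] a)
  moreover have "(\<lambda>h. \<Sum>b\<in>B. \<phi> b (a x) *\<^sub>R L' b h + \<phi> b (a' h) *\<^sub>R L x b)
      = (\<lambda>h. L' (a x) h + L x (a' h))"
    by (simp only: sum.distrib L'_sum[symmetric] L_sum[OF assms(3), symmetric])
  ultimately have "((\<lambda>y. \<Sum>b\<in>B. \<phi> b (a y) *\<^sub>R L y b) has_derivative
      (\<lambda>h. L' (a x) h + L x (a' h))) (at x)" by simp
  then show ?thesis
    by (rule has_derivative_transform_within_open[OF _ assms(2,3)]) (rule L_sum[symmetric])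
qed

section \<open>Partial derivatives and symmetry of second derivatives\<close>

lemma has_derivative_fst_partial:
  assumes "(f has_derivative D) (at (x, y))"
  shows "((\<lambda>x. f (x, y)) has_derivative (\<lambda>u. D (u, 0))) (at x)"
proof -
  have "((\<lambda>x. (x, y)) has_derivative (\<lambda>u. (u, 0))) (at x)"
    by (auto intro!: derivative_eq_intros)
  from has_derivative_compose[OF this assms] show ?thesis .
qed

lemma has_derivative_snd_partial:
  assumes "(f has_derivative D) (at (x, y))"
  shows "((\<lambda>y. f (x, y)) has_derivative (\<lambda>v. D (0, v))) (at y)"
proof -
  have "((\<lambda>y. (x, y)) has_derivative (\<lambda>v. (0, v))) (at y)"
    by (auto intro!: derivative_eq_intros)
  from has_derivative_compose[OF this assms] show ?thesis .
qed

text \<open>The second difference is the increment over \<open>{0..t}\<close> of the difference of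
  \<open>f\<close> along two parallel segments in direction \<open>u\<close>. The derivative of that
  difference is close to \<open>t *\<^sub>R F v\<close>, by differentiability of the directional
  derivative at the single point \<open>x\<close>, and the mean value inequality gives the
  bound.\<close>

lemma second_difference_bound:
  fixes f :: "'a::real_normed_vector \<Rightarrow> 'b::real_normed_vector"
  assumes "open S" "x \<in> S" and diff: "\<And>y. y \<in> S \<Longrightarrow> f differentiable (at y)"
    and F: "((\<lambda>y. frechet_derivative f (at y) u) has_derivative F) (at x)"
    and "\<epsilon> > 0"
  shows "\<exists>\<delta>>0. \<forall>t. 0 < t \<and> t < \<delta> \<longrightarrow>
    norm (f (x + t *\<^sub>R u + t *\<^sub>R v) - f (x + t *\<^sub>R u) - f (x + t *\<^sub>R v) + f x - t\<^sup>2 *\<^sub>R F v) \<le> \<epsilon> * t\<^sup>2"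
proof -
  let ?D = "\<lambda>y. frechet_derivative f (at y) u"
  \<comment> \<open>The parallelogram with sides \<open>t *\<^sub>R u\<close> and
    \<open>t *\<^sub>R v\<close> lies within \<open>t * M\<close> of \<open>x\<close>; the summand 1
    keeps \<open>M\<close> positive. The factor 2 in \<open>e\<close> makes room for the two errors
    added in \<open>g'_bound\<close>.\<close>
  define M where "M = norm u + norm v + 1"
  have M: "M > 0" unfolding M_def by (simp add: add_nonneg_pos)
  define e where "e = \<epsilon> / (2 * M)"
  have e: "e > 0" using M \<open>\<epsilon> > 0\<close> by (simp add: e_def)
  obtain r where r: "r > 0" "ball x r \<subseteq> S" using assms openE by blast
  have linF: "linear F" using F has_derivative_linear by blast
  obtain d where d: "d > 0" "\<And>y. norm (y - x) < d \<Longrightarrow> norm (?D y - ?D x - F (y - x)) \<le> e * norm (y - x)"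
    using F e unfolding has_derivative_at_alt by blast
  show ?thesis
  proof (intro exI[of _ "min d r / M"] conjI allI impI)
    show "min d r / M > 0" using d r M by simp
    fix t assume t: "0 < t \<and> t < min d r / M"
    then have tM: "t * M < d" "t * M < r" using M by (auto simp: field_simps)
    have near: "norm (s *\<^sub>R u + c *\<^sub>R v) \<le> t * M" if "s \<in> {0..t}" "c \<in> {0..t}" for s c
    proof -
      have "norm (s *\<^sub>R u + c *\<^sub>R v) \<le> s * norm u + c * norm v"
        using norm_triangle_ineq[of "s *\<^sub>R u" "c *\<^sub>R v"] that by simp
      also have "\<dots> \<le> t * norm u + t * norm v"
        using that by (intro add_mono mult_right_mono) auto
      also have "\<dots> \<le> t * M" using t by (simp add: M_def algebra_simps)
      finally show ?thesis .
    qed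
    have inS: "x + s *\<^sub>R u + c *\<^sub>R v \<in> S" if "s \<in> {0..t}" "c \<in> {0..t}" for s c
    proof -
      have "dist x (x + s *\<^sub>R u + c *\<^sub>R v) = norm (s *\<^sub>R u + c *\<^sub>R v)"
        using norm_minus_cancel[of "s *\<^sub>R u + c *\<^sub>R v"] by (simp add: dist_norm add.assoc)
      then show ?thesis using near[OF that] tM r by auto
    qed
    have D_near: "norm (?D (x + s *\<^sub>R u + c *\<^sub>R v) - ?D x - F (s *\<^sub>R u + c *\<^sub>R v)) \<le> e * (t * M)"
      if "s \<in> {0..t}" "c \<in> {0..t}" for s c
    proof -
      have "norm (s *\<^sub>R u + c *\<^sub>R v) < d" using near[OF that] tM by linarith
      then have "norm (?D (x + s *\<^sub>R u + c *\<^sub>R v) - ?D x - F (s *\<^sub>R u + c *\<^sub>R v))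
          \<le> e * norm (s *\<^sub>R u + c *\<^sub>R v)"
        using d(2)[of "x + s *\<^sub>R u + c *\<^sub>R v"] by (simp add: add.assoc)
      also have "\<dots> \<le> e * (t * M)" using near[OF that] e by simp
      finally show ?thesis .
    qed
    \<comment> \<open>Subtracting the linear term makes the derivative of \<open>g\<close> small.
      The summand \<open>0 *\<^sub>R v\<close> lets \<open>f_line\<close> and \<open>D_near\<close>
      apply with \<open>c = 0\<close>.\<close>
    define g where "g s = f (x + s *\<^sub>R u + t *\<^sub>R v) - f (x + s *\<^sub>R u + 0 *\<^sub>R v) - s *\<^sub>R (t *\<^sub>R F v)" for s
    define g' where "g' s = ?D (x + s *\<^sub>R u + t *\<^sub>R v) - ?D (x + s *\<^sub>R u + 0 *\<^sub>R v) - t *\<^sub>R F v" for s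
    have f_line: "((\<lambda>s. f (x + s *\<^sub>R u + c *\<^sub>R v)) has_derivative
        (\<lambda>h. h *\<^sub>R ?D (x + s *\<^sub>R u + c *\<^sub>R v))) (at s within T)"
      if "s \<in> {0..t}" "c \<in> {0..t}" for s c T
    proof -
      let ?y = "x + s *\<^sub>R u + c *\<^sub>R v"
      have "(f has_derivative frechet_derivative f (at ?y)) (at ?y)"
        using diff[OF inS[OF that]] frechet_derivative_works by blast
      moreover have "((\<lambda>s. x + s *\<^sub>R u + c *\<^sub>R v) has_derivative (\<lambda>h. h *\<^sub>R u)) (at s within T)"
        by (auto intro!: derivative_eq_intros)
      ultimately have "((\<lambda>s. f (x + s *\<^sub>R u + c *\<^sub>R v)) has_derivative
          (\<lambda>h. frechet_derivative f (at ?y) (h *\<^sub>R u))) (at s within T)"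
        using has_derivative_compose by blast
      then show ?thesis
        using linear_scale[OF linear_frechet_derivative[OF diff[OF inS[OF that]]]] by simp
    qed
    have g_der: "(g has_derivative (\<lambda>h. h *\<^sub>R g' s)) (at s within {0..t})" if "s \<in> {0..t}" for s
    proof -
      have "(g has_derivative (\<lambda>h. h *\<^sub>R ?D (x + s *\<^sub>R u + t *\<^sub>R v) - h *\<^sub>R ?D (x + s *\<^sub>R u + 0 *\<^sub>R v)
          - h *\<^sub>R (t *\<^sub>R F v))) (at s within {0..t})"
        unfolding g_def
        by (intro has_derivative_diff f_line has_derivative_scaleR_left has_derivative_ident)
          (use t that in auto)
      then show ?thesis by (simp add: g'_def scaleR_diff_right)
    qed
    have g'_bound: "norm (g' s) \<le> \<epsilon> * t" if s: "s \<in> {0..t}" for s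
    proof -
      have "g' s = (?D (x + s *\<^sub>R u + t *\<^sub>R v) - ?D x - F (s *\<^sub>R u + t *\<^sub>R v))
          - (?D (x + s *\<^sub>R u + 0 *\<^sub>R v) - ?D x - F (s *\<^sub>R u + 0 *\<^sub>R v))"
        by (simp add: g'_def linear_add[OF linF] linear_scale[OF linF])
      then have "norm (g' s) \<le> e * (t * M) + e * (t * M)"
        using norm_triangle_ineq4 D_near[OF s, of t] D_near[OF s, of 0] t
        by (smt (verit, best) atLeastAtMost_iff)
      also have "\<dots> = \<epsilon> * t" using M by (simp add: e_def field_simps)
      finally show ?thesis .
    qed
    have "norm (g t - g 0) \<le> \<epsilon> * t * norm (t - 0)"
    proof (rule differentiable_bound[OF _ g_der])
      fix s assume "s \<in> {0..t}"
      have "norm (h *\<^sub>R g' s) \<le> \<epsilon> * t * norm h" for h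
        using mult_left_mono[OF g'_bound[OF \<open>s \<in> {0..t}\<close>], of "\<bar>h\<bar>"] by (simp add: mult.commute)
      then show "onorm (\<lambda>h. h *\<^sub>R g' s) \<le> \<epsilon> * t" by (rule onorm_le)
    qed (use t in auto)
    moreover have "g t - g 0 =
        f (x + t *\<^sub>R u + t *\<^sub>R v) - f (x + t *\<^sub>R u) - f (x + t *\<^sub>R v) + f x - t\<^sup>2 *\<^sub>R F v"
      by (simp add: g_def power2_eq_square)
    ultimately show "norm (f (x + t *\<^sub>R u + t *\<^sub>R v) - f (x + t *\<^sub>R u) - f (x + t *\<^sub>R v) + f x
        - t\<^sup>2 *\<^sub>R F v) \<le> \<epsilon> * t\<^sup>2"
      using t by (simp add: power2_eq_square mult.assoc)
  qed
qed

text \<open>The second difference is symmetric in \<open>u\<close> and \<open>v\<close>; divided by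
  \<open>t\<^sup>2\<close> it tends to both \<open>F v\<close> and \<open>G u\<close>.\<close>

lemma symmetric_second_derivative:
  fixes f :: "'a::real_normed_vector \<Rightarrow> 'b::real_normed_vector"
  assumes "open S" "x \<in> S" "\<And>y. y \<in> S \<Longrightarrow> f differentiable (at y)"
    and u: "((\<lambda>y. frechet_derivative f (at y) u) has_derivative F) (at x)"
    and v: "((\<lambda>y. frechet_derivative f (at y) v) has_derivative G) (at x)"
  shows "F v = G u"
proof (rule ccontr)
  assume "F v \<noteq> G u"
  \<comment> \<open>A third of the gap: two errors of size \<open>\<epsilon>\<close> cannot add up
    to it.\<close>
  define \<epsilon> where "\<epsilon> = norm (F v - G u) / 3"
  have \<epsilon>: "\<epsilon> > 0" using \<open>F v \<noteq> G u\<close> by (simp add: \<epsilon>_def)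
  let ?d = "\<lambda>t. f (x + t *\<^sub>R u + t *\<^sub>R v) - f (x + t *\<^sub>R u) - f (x + t *\<^sub>R v) + f x"
  obtain a where a: "a > 0" "\<And>t. 0 < t \<Longrightarrow> t < a \<Longrightarrow> norm (?d t - t\<^sup>2 *\<^sub>R F v) \<le> \<epsilon> * t\<^sup>2"
    using second_difference_bound[OF assms(1-3) u \<epsilon>, of v] by blast
  obtain b where b: "b > 0" "\<And>t. 0 < t \<Longrightarrow> t < b \<Longrightarrow> norm (?d t - t\<^sup>2 *\<^sub>R G u) \<le> \<epsilon> * t\<^sup>2"
    using second_difference_bound[OF assms(1-3) v \<epsilon>, of u] by (auto simp: algebra_simps)
  define t where "t = min a b / 2"
  have t: "0 < t" "t < a" "t < b" using a b by (auto simp: t_def)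
  have "t\<^sup>2 *\<^sub>R (F v - G u) = (?d t - t\<^sup>2 *\<^sub>R G u) - (?d t - t\<^sup>2 *\<^sub>R F v)"
    by (simp add: scaleR_diff_right)
  then have "norm (t\<^sup>2 *\<^sub>R (F v - G u)) \<le> \<epsilon> * t\<^sup>2 + \<epsilon> * t\<^sup>2"
    using norm_triangle_ineq4 a(2)[OF t(1,2)] b(2)[OF t(1,3)] by (smt (verit))
  moreover have "norm (t\<^sup>2 *\<^sub>R (F v - G u)) = t\<^sup>2 * (3 * \<epsilon>)" by (simp add: \<epsilon>_def)
  ultimately have "t\<^sup>2 * (3 * \<epsilon>) \<le> t\<^sup>2 * (2 * \<epsilon>)" by (simp add: algebra_simps)
  then show False using t \<epsilon> by simp
qed

section \<open>Calculus of iterated directional derivatives\<close>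

lemma k_smooth_on_subset: "k_smooth_on k S f \<Longrightarrow> T \<subseteq> S \<Longrightarrow> k_smooth_on k T f"
proof (induction k arbitrary: f)
  case 0
  then show ?case by (auto intro: continuous_on_subset)
next
  case (Suc k)
  then show ?case unfolding k_smooth_on.simps by blast
qed

lemma k_smooth_on_SucD: "k_smooth_on (Suc k) S f \<Longrightarrow> k_smooth_on k S f"
proof (induction k arbitrary: f)
  case 0
  then show ?case
    by (auto intro!: continuous_at_imp_continuous_on differentiable_imp_continuous_within)
next
  case (Suc k)
  then show ?case using k_smooth_on.simps(2) by metis
qed

text \<open>Derivatives are taken in the full space, so openness turns agreement on \<open>S\<close>
  into equal derivatives there.\<close>

lemma k_smooth_on_cong:
  assumes "k_smooth_on k S f" "open S" "\<And>x. x \<in> S \<Longrightarrow> f x = g x"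
  shows "k_smooth_on k S g"
  using assms(1,3)
proof (induction k arbitrary: f g)
  case 0
  then show ?case by (simp cong: continuous_on_cong)
next
  case (Suc k)
  have "(g has_derivative frechet_derivative f (at x)) (at x)" if "x \<in> S" for x
    using has_derivative_transform_within_open[OF _ assms(2) that, of f] Suc.prems that
    by (simp add: frechet_derivative_works)
  note g = this
  have "frechet_derivative f (at x) v = frechet_derivative g (at x) v" if "x \<in> S" for x v
    by (rule fun_cong[OF frechet_derivative_at[OF g[OF that]]])
  then have "k_smooth_on k S (\<lambda>x. frechet_derivative g (at x) v)" for v
    using Suc.IH[of "\<lambda>x. frechet_derivative f (at x) v"] Suc.prems by simp
  then show ?case using g by (auto simp: differentiable_def)
qed

text \<open>Allows an explicit formula for the derivative in place of
  \<open>frechet_derivative\<close>.\<close>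

lemma k_smooth_on_SucI:
  assumes "open S" "\<And>x. x \<in> S \<Longrightarrow> (f has_derivative f' x) (at x)"
    and "\<And>v. k_smooth_on k S (\<lambda>x. f' x v)"
  shows "k_smooth_on (Suc k) S f"
proof -
  have "f' x v = frechet_derivative f (at x) v" if "x \<in> S" for x v
    by (rule fun_cong[OF frechet_derivative_at[OF assms(2)[OF that]]])
  then have "k_smooth_on k S (\<lambda>x. frechet_derivative f (at x) v)" for v
    by (rule k_smooth_on_cong[OF assms(3,1)])
  then show ?thesis using assms(2) by (auto simp: differentiable_def)
qed

lemma k_smooth_on_SucE:
  assumes "k_smooth_on (Suc k) S f"
  shows "\<And>x. x \<in> S \<Longrightarrow> (f has_derivative frechet_derivative f (at x)) (at x)"
    and "\<And>v. k_smooth_on k S (\<lambda>x. frechet_derivative f (at x) v)"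
  using assms by (simp_all add: frechet_derivative_works[symmetric])

text \<open>Composite maps are examined through an intermediate chart that depends on the point;
  this glues the local results.\<close>

lemma k_smooth_on_local:
  "(\<And>x. x \<in> S \<Longrightarrow> \<exists>U. open U \<and> x \<in> U \<and> k_smooth_on k U f) \<Longrightarrow> k_smooth_on k S f"
proof (induction k arbitrary: f)
  case 0
  have "continuous (at x) f" if "x \<in> S" for x
    using 0[OF that] by (auto simp: continuous_on_eq_continuous_at)
  then show ?case by (simp add: continuous_at_imp_continuous_on)
next
  case (Suc k)
  have "f differentiable (at x)" if "x \<in> S" for x
    using Suc.prems[OF that] by auto
  moreover have "k_smooth_on k S (\<lambda>x. frechet_derivative f (at x) v)" for v
  proof (rule Suc.IH)
    fix x assume "x \<in> S"
    then obtain U where "open U" "x \<in> U" "k_smooth_on (Suc k) U f" using Suc.prems by blast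
    then show "\<exists>U. open U \<and> x \<in> U \<and> k_smooth_on k U (\<lambda>x. frechet_derivative f (at x) v)"
      using k_smooth_on_SucE(2) by blast
  qed
  ultimately show ?case by simp
qed

lemma k_smooth_on_const: "k_smooth_on k S (\<lambda>x. c)"
  by (induction k arbitrary: c) auto

lemma k_smooth_on_bounded_linear:
  assumes "bounded_linear f" "open S"
  shows "k_smooth_on k S f"
proof (cases k)
  case 0
  then show ?thesis using assms by (simp add: linear_continuous_on)
next
  case (Suc m)
  then show ?thesis
    using k_smooth_on_SucI[OF assms(2) bounded_linear_imp_has_derivative[OF assms(1)]]
      k_smooth_on_const by blast
qed

lemma k_smooth_on_add:
  assumes "open S" "k_smooth_on k S f" "k_smooth_on k S g"
  shows "k_smooth_on k S (\<lambda>x. f x + g x)"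
  using assms(2,3)
proof (induction k arbitrary: f g)
  case 0
  then show ?case by (simp add: continuous_on_add)
next
  case (Suc k)
  show ?case
    by (rule k_smooth_on_SucI[OF assms(1) has_derivative_add])
      (use Suc.IH Suc.prems[THEN k_smooth_on_SucE(1)] Suc.prems[THEN k_smooth_on_SucE(2)] in blast)+
qed

lemma k_smooth_on_sum:
  assumes "open S" "\<And>i. i \<in> I \<Longrightarrow> k_smooth_on k S (f i)"
  shows "k_smooth_on k S (\<lambda>x. \<Sum>i\<in>I. f i x)"
  using assms(2)
  by (induction I rule: infinite_finite_induct)
    (auto intro!: k_smooth_on_const k_smooth_on_add assms(1))

lemma k_smooth_on_bounded_bilinear:
  assumes "bounded_bilinear pr" "open S" "k_smooth_on k S f" "k_smooth_on k S g"
  shows "k_smooth_on k S (\<lambda>x. pr (f x) (g x))"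
  using assms(3,4)
proof (induction k arbitrary: f g)
  case 0
  then show ?case using assms(1) by (simp add: bounded_bilinear.continuous_on)
next
  case (Suc k)
  show ?case
  proof (rule k_smooth_on_SucI[OF assms(2)])
    show "((\<lambda>x. pr (f x) (g x)) has_derivative (\<lambda>v. pr (f x) (frechet_derivative g (at x) v)
        + pr (frechet_derivative f (at x) v) (g x))) (at x)" if "x \<in> S" for x
      by (intro bounded_bilinear.FDERIV[OF assms(1)] Suc.prems[THEN k_smooth_on_SucE(1)] that)
    show "k_smooth_on k S (\<lambda>x. pr (f x) (frechet_derivative g (at x) v)
        + pr (frechet_derivative f (at x) v) (g x))" for v
      by (intro k_smooth_on_add assms(2) Suc.IH k_smooth_on_SucE(2) Suc.prems
          Suc.prems[THEN k_smooth_on_SucD])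
  qed
qed

lemma k_smooth_on_linear_compose:
  assumes "bounded_linear L" "open S" "k_smooth_on k S f"
  shows "k_smooth_on k S (\<lambda>x. L (f x))"
  using assms(3)
proof (induction k arbitrary: f)
  case 0
  then show ?case by (simp add: bounded_linear.continuous_on[OF assms(1)])
next
  case (Suc k)
  show ?case
    by (rule k_smooth_on_SucI[OF assms(2) bounded_linear.has_derivative[OF assms(1)]])
      (use Suc.IH Suc.prems[THEN k_smooth_on_SucE(1)] Suc.prems[THEN k_smooth_on_SucE(2)] in blast)+
qed

text \<open>Finite dimension of the middle space makes \<open>Dg (f x) (Df x v)\<close> a finite sum of products
  of smooth functions, although smoothness only speaks about directional derivatives.\<close>

lemma k_smooth_on_compose:
  fixes f :: "'a::real_normed_vector \<Rightarrow> 'b::real_normed_vector"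
    and g :: "'b \<Rightarrow> 'c::real_normed_vector"
  assumes "finite_dim TYPE('b)" "open S" "f ` S \<subseteq> T" "k_smooth_on k S f" "k_smooth_on k T g"
  shows "k_smooth_on k S (\<lambda>x. g (f x))"
  using assms(4,5)
proof (induction k arbitrary: g)
  case 0
  then show ?case using assms(3) by (auto intro: continuous_on_compose2)
next
  case (Suc k)
  obtain B :: "'b set" and \<phi> where B: "finite B" "\<And>b. bounded_linear (\<phi> b :: 'b \<Rightarrow> real)"
    "\<And>x. x = (\<Sum>b\<in>B. \<phi> b x *\<^sub>R b)"
    using finite_dim_coordinates[OF assms(1)] by blast
  note f = k_smooth_on_SucE[OF Suc.prems(1)] and g = k_smooth_on_SucE[OF Suc.prems(2)]
  have g_sum: "frechet_derivative g (at (f x)) w = (\<Sum>b\<in>B. \<phi> b w *\<^sub>R frechet_derivative g (at (f x)) b)"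
    if "x \<in> S" for x w
  proof -
    have lin: "linear (frechet_derivative g (at (f x)))"
      using g(1)[of "f x"] that assms(3) has_derivative_linear by blast
    show ?thesis
      by (subst B(3)[of w]) (simp add: linear_sum[OF lin] linear_scale[OF lin])
  qed
  show ?case
  proof (rule k_smooth_on_SucI[OF assms(2)])
    show "((\<lambda>x. g (f x)) has_derivative
      (\<lambda>v. frechet_derivative g (at (f x)) (frechet_derivative f (at x) v))) (at x)" if "x \<in> S" for x
      using has_derivative_compose[OF f(1)[OF that] g(1)] that assms(3) by blast
    show "k_smooth_on k S (\<lambda>x. frechet_derivative g (at (f x)) (frechet_derivative f (at x) v))" for v
    proof (rule k_smooth_on_cong[OF _ assms(2) g_sum[symmetric]])
      show "k_smooth_on k S (\<lambda>x. \<Sum>b\<in>B. \<phi> b (frechet_derivative f (at x) v) *\<^sub>R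
          frechet_derivative g (at (f x)) b)"
        by (intro k_smooth_on_sum assms(2) k_smooth_on_bounded_bilinear[OF bounded_bilinear_scaleR]
            k_smooth_on_linear_compose[OF B(2)] Suc.IH f(2) g(2) k_smooth_on_SucD[OF Suc.prems(1)])
    qed
  qed
qed

lemma smooth_on_subset: "smooth_on S f \<Longrightarrow> T \<subseteq> S \<Longrightarrow> smooth_on T f"
  unfolding smooth_on_def using k_smooth_on_subset by blast

lemma smooth_on_cong:
  "smooth_on S f \<Longrightarrow> open S \<Longrightarrow> (\<And>x. x \<in> S \<Longrightarrow> f x = g x) \<Longrightarrow> smooth_on S g"
  unfolding smooth_on_def using k_smooth_on_cong by blast

lemma smooth_on_local:
  assumes "\<And>x. x \<in> S \<Longrightarrow> \<exists>U. open U \<and> x \<in> U \<and> smooth_on U f"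
  shows "smooth_on S f"
  unfolding smooth_on_def
proof (intro allI k_smooth_on_local)
  fix k x assume "x \<in> S"
  from assms[OF this] show "\<exists>U. open U \<and> x \<in> U \<and> k_smooth_on k U f"
    unfolding smooth_on_def by blast
qed

lemma smooth_on_const: "smooth_on S (\<lambda>x. c)"
  unfolding smooth_on_def using k_smooth_on_const by blast

lemma smooth_on_bounded_linear: "bounded_linear f \<Longrightarrow> open S \<Longrightarrow> smooth_on S f"
  unfolding smooth_on_def using k_smooth_on_bounded_linear by blast

lemma smooth_on_compose:
  fixes f :: "'a::real_normed_vector \<Rightarrow> 'b::real_normed_vector"
  assumes "finite_dim TYPE('b)" "open S" "f ` S \<subseteq> T" "smooth_on S f" "smooth_on T g"
  shows "smooth_on S (\<lambda>x. g (f x))"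
  using assms(4,5) k_smooth_on_compose[OF assms(1-3)] unfolding smooth_on_def by blast

lemma smooth_on_Pair:
  fixes f :: "'a::real_normed_vector \<Rightarrow> 'b::real_normed_vector"
    and g :: "'a \<Rightarrow> 'c::real_normed_vector"
  assumes "open S" "smooth_on S f" "smooth_on S g"
  shows "smooth_on S (\<lambda>x. (f x, g x))"
proof -
  have "bounded_linear (\<lambda>x::'b. (x, 0::'c))" "bounded_linear (\<lambda>y::'c. (0::'b, y))"
    by (auto intro!: bounded_linear_Pair bounded_linear_ident bounded_linear_zero)
  then have "k_smooth_on k S (\<lambda>x. (f x, 0) + (0, g x))" for k
    using assms k_smooth_on_linear_compose[of "\<lambda>x. (x, 0)" S k f]
      k_smooth_on_linear_compose[of "\<lambda>y. (0, y)" S k g]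
    unfolding smooth_on_def by (intro k_smooth_on_add) blast+
  then show ?thesis by (simp add: smooth_on_def)
qed

lemma smooth_on_add:
  "open S \<Longrightarrow> smooth_on S f \<Longrightarrow> smooth_on S g \<Longrightarrow> smooth_on S (\<lambda>x. f x + g x)"
  unfolding smooth_on_def using k_smooth_on_add by blast

lemma smooth_on_bounded_bilinear:
  "bounded_bilinear pr \<Longrightarrow> open S \<Longrightarrow> smooth_on S f \<Longrightarrow> smooth_on S g
    \<Longrightarrow> smooth_on S (\<lambda>x. pr (f x) (g x))"
  unfolding smooth_on_def using k_smooth_on_bounded_bilinear by blast

lemma smooth_on_differentiable:
  assumes "smooth_on S f" "x \<in> S"
  shows "f differentiable (at x)"
proof -
  have "k_smooth_on (Suc 0) S f" using assms(1) by (simp only: smooth_on_def)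
  from k_smooth_on_SucE(1)[OF this assms(2)] show ?thesis by (rule differentiableI)
qed

lemma smooth_on_frechet_derivative:
  assumes "smooth_on S f"
  shows "smooth_on S (\<lambda>x. frechet_derivative f (at x) v)"
  unfolding smooth_on_def
proof
  fix k
  have "k_smooth_on (Suc k) S f" using assms by (simp only: smooth_on_def)
  then show "k_smooth_on k S (\<lambda>x. frechet_derivative f (at x) v)" by (rule k_smooth_on_SucE(2))
qed

section \<open>Smooth maps between manifolds\<close>

text \<open>The notion of a smooth manifold without the topological side conditions, which are not
  available for an arbitrary normed space.\<close>

definition atlas :: "('m::topological_space, 'e::real_normed_vector) chart set \<Rightarrow> bool" where
  "atlas A \<longleftrightarrow> finite_dim TYPE('e) \<and> (\<forall>c\<in>A. is_chart c) \<and> (\<Union>c\<in>A. fst c) = UNIV \<and>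
     (\<forall>c\<in>A. \<forall>d\<in>A. smooth_on (snd c ` (fst c \<inter> fst d)) (snd d \<circ> chart_inv c))"

lemma smooth_manifold_atlas: "smooth_manifold A \<Longrightarrow> atlas A"
  by (simp add: smooth_manifold_def atlas_def)

lemma atlas_chart: "atlas A \<Longrightarrow> c \<in> A \<Longrightarrow> is_chart c"
  by (simp add: atlas_def)

lemma atlas_finite_dim: "atlas (A :: ('m::topological_space, 'e::real_normed_vector) chart set)
    \<Longrightarrow> finite_dim TYPE('e)"
  by (simp add: atlas_def)

lemma atlas_cover:
  assumes "atlas A"
  obtains c where "c \<in> A" "p \<in> fst c"
  using assms unfolding atlas_def by blast

lemma is_chart_inj:
  assumes "is_chart c"
  shows "inj_on (snd c) (fst c)"
proof -
  obtain g where "homeomorphism (fst c) (snd c ` fst c) (snd c) g"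
    using assms unfolding is_chart_def by blast
  then show ?thesis by (intro inj_on_inverseI[of _ g]) (rule homeomorphism_apply1)
qed

lemma chart_inv_snd: "is_chart c \<Longrightarrow> p \<in> fst c \<Longrightarrow> chart_inv c (snd c p) = p"
  by (rule inv_into_f_f[OF is_chart_inj])

lemma is_chart_open: "is_chart c \<Longrightarrow> open (fst c)"
  by (simp add: is_chart_def)

lemma is_chart_continuous: "is_chart c \<Longrightarrow> continuous_on (fst c) (snd c)"
  unfolding is_chart_def homeomorphism_def by blast

lemma is_chart_continuous_inv:
  assumes "is_chart c"
  shows "continuous_on (snd c ` fst c) (chart_inv c)"
proof -
  obtain g where g: "homeomorphism (fst c) (snd c ` fst c) (snd c) g"
    using assms unfolding is_chart_def by blast
  have "g y = chart_inv c y" if "y \<in> snd c ` fst c" for y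
    using that g chart_inv_snd[OF assms] unfolding homeomorphism_def by force
  moreover have "continuous_on (snd c ` fst c) g" using g unfolding homeomorphism_def by blast
  ultimately show ?thesis by (simp cong: continuous_on_cong)
qed

lemma is_chart_open_image:
  assumes "is_chart c" "open S"
  shows "open (snd c ` (S \<inter> fst c))"
proof -
  have "snd c ` (S \<inter> fst c) = (snd c ` fst c) \<inter> chart_inv c -` S"
    using chart_inv_snd[OF assms(1)] by force
  then show ?thesis
    using continuous_open_preimage[OF is_chart_continuous_inv[OF assms(1)] _ assms(2)] assms(1)
    by (simp add: is_chart_def)
qed

lemma continuous_at_chart_inv:
  assumes "is_chart c" "p \<in> fst c"
  shows "continuous (at (snd c p)) (chart_inv c)"
  using is_chart_continuous_inv[OF assms(1)] assms
  by (simp add: is_chart_def continuous_on_eq_continuous_at)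

lemma continuous_at_preimage_open:
  assumes "continuous (at x) f" "open T" "f x \<in> T"
  obtains V where "open V" "x \<in> V" "f ` V \<subseteq> T"
proof -
  obtain V where "open V" "x \<in> V" "\<forall>y\<in>V. f y \<in> T"
    using assms unfolding continuous_at_open by blast
  then show ?thesis using that by blast
qed

text \<open>The chain rule with a chart inserted: by continuity \<open>f\<close> stays in the chart
  domain near \<open>x\<close>, where \<open>chart_inv c\<close> undoes
  \<open>snd c\<close>.\<close>

lemma chain_through_chart:
  fixes f :: "'a::real_normed_vector \<Rightarrow> 'm::topological_space"
    and c :: "('m, 'e::real_normed_vector) chart" and h :: "'m \<Rightarrow> 'b::real_normed_vector"
  assumes "is_chart c" "continuous (at x) f" "f x \<in> fst c"
    and D: "((\<lambda>y. snd c (f y)) has_derivative D) (at x)"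
    and E: "((\<lambda>z. h (chart_inv c z)) has_derivative E) (at (snd c (f x)))"
  shows "((\<lambda>y. h (f y)) has_derivative (\<lambda>v. E (D v))) (at x)"
proof -
  obtain V where V: "open V" "x \<in> V" "f ` V \<subseteq> fst c"
    using continuous_at_preimage_open assms(2,3) is_chart_open[OF assms(1)] by metis
  show ?thesis
  proof (rule has_derivative_transform_within_open[OF has_derivative_compose[OF D E] V(1,2)])
    fix y assume "y \<in> V"
    then show "h (chart_inv c (snd c (f y))) = h (f y)"
      using V(3) chart_inv_snd[OF assms(1)] by auto
  qed
qed

lemma open_chart_domain:
  assumes "is_chart c" "is_chart d" "open S" "continuous_on S f"
  shows "open (snd c ` (S \<inter> fst c \<inter> f -` fst d))"
proof -
  have "open (S \<inter> f -` fst d)"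
    by (rule continuous_open_preimage[OF assms(4,3) is_chart_open[OF assms(2)]])
  from is_chart_open_image[OF assms(1) this] show ?thesis by (simp add: Int_ac)
qed

lemma smooth_map_onD:
  assumes "smooth_map_on A B S f" "c \<in> A" "d \<in> B"
  shows "smooth_on (snd c ` (S \<inter> fst c \<inter> f -` fst d)) (\<lambda>y. snd d (f (chart_inv c y)))"
  using assms by (simp add: smooth_map_on_def o_def)

lemma smooth_map_on_continuous: "smooth_map_on A B S f \<Longrightarrow> continuous_on S f"
  by (simp add: smooth_map_on_def)

lemma smooth_map_continuous_at: "smooth_map A B f \<Longrightarrow> continuous (at x) f"
  by (drule smooth_map_on_continuous) (simp add: continuous_on_eq_continuous_at)

lemma smooth_map_on_subset:
  "smooth_map_on A B S f \<Longrightarrow> T \<subseteq> S \<Longrightarrow> smooth_map_on A B T f"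
  unfolding smooth_map_on_def by (blast intro: continuous_on_subset smooth_on_subset)

lemma smooth_map_on_compose:
  assumes A: "atlas A" and B: "atlas B" and C: "atlas C" and S: "open S"
    and f: "smooth_map_on A B S f" and g: "smooth_map B C g"
  shows "smooth_map_on A C S (\<lambda>x. g (f x))"
  unfolding smooth_map_on_def o_def
proof (intro conjI ballI)
  note cf = smooth_map_on_continuous[OF f] and cg = smooth_map_on_continuous[OF g]
  show "continuous_on S (\<lambda>x. g (f x))"
    using continuous_on_compose2[OF cg cf] by simp
  fix c e assume c: "c \<in> A" and e: "e \<in> C"
  have chart_c: "is_chart c" and chart_e: "is_chart e"
    using A C c e atlas_chart by blast+
  show "smooth_on (snd c ` (S \<inter> fst c \<inter> (\<lambda>x. g (f x)) -` fst e)) (\<lambda>y. snd e (g (f (chart_inv c y))))"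
  proof (rule smooth_on_local)
    fix y assume "y \<in> snd c ` (S \<inter> fst c \<inter> (\<lambda>x. g (f x)) -` fst e)"
    then obtain p where p: "p \<in> S" "p \<in> fst c" "g (f p) \<in> fst e" "y = snd c p" by blast
    obtain d where d: "d \<in> B" "f p \<in> fst d" by (rule atlas_cover[OF B])
    have chart_d: "is_chart d" using B d atlas_chart by blast
    have "open (UNIV \<inter> g -` fst e)"
      by (rule continuous_open_preimage[OF cg open_UNIV is_chart_open[OF chart_e]])
    then have "open (fst d \<inter> g -` fst e)"
      using is_chart_open[OF chart_d] by auto
    then have "open (S \<inter> f -` (fst d \<inter> g -` fst e))"
      by (rule continuous_open_preimage[OF cf S])
    \<comment> \<open>The coordinates of the points that \<open>f\<close> sends into
      \<open>d\<close> and \<open>g\<close> then sends into \<open>e\<close>; there the inserted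
      chart \<open>d\<close> and its inverse cancel.\<close>
    then have U: "open (snd c ` (S \<inter> f -` (fst d \<inter> g -` fst e) \<inter> fst c))" (is "open ?U")
      by (rule is_chart_open_image[OF chart_c])
    have "smooth_on ?U (\<lambda>y. snd e (g (chart_inv d (snd d (f (chart_inv c y))))))"
    proof (rule smooth_on_compose[OF atlas_finite_dim[OF B] U _ _ smooth_map_onD[OF g d(1) e]])
      show "(\<lambda>y. snd d (f (chart_inv c y))) ` ?U \<subseteq> snd d ` (UNIV \<inter> fst d \<inter> g -` fst e)"
        using chart_inv_snd[OF chart_c] by auto
      show "smooth_on ?U (\<lambda>y. snd d (f (chart_inv c y)))"
        by (rule smooth_on_subset[OF smooth_map_onD[OF f c d(1)]]) blast
    qed
    then have "smooth_on ?U (\<lambda>y. snd e (g (f (chart_inv c y))))"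
      by (rule smooth_on_cong[OF _ U]) (auto simp: chart_inv_snd[OF chart_c] chart_inv_snd[OF chart_d])
    moreover have "y \<in> ?U" using p d by blast
    ultimately show "\<exists>U. open U \<and> y \<in> U \<and> smooth_on U (\<lambda>y. snd e (g (f (chart_inv c y))))"
      using U by blast
  qed
qed

lemma smooth_map_id: "atlas A \<Longrightarrow> smooth_map A A (\<lambda>x. x)"
  by (simp add: smooth_map_on_def atlas_def o_def vimage_def Int_def conj_commute)

lemma smooth_map_const: "smooth_map A B (\<lambda>x. p)"
  by (simp add: smooth_map_on_def o_def smooth_on_const)

section \<open>Product manifolds\<close>

abbreviation prod_chart :: "('m, 'e) chart \<Rightarrow> ('n, 'f) chart \<Rightarrow> ('m \<times> 'n, 'e \<times> 'f) chart" where
  "prod_chart c d \<equiv> (fst c \<times> fst d, map_prod (snd c) (snd d))"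

lemma chart_inv_prod:
  assumes "is_chart c" "is_chart d" "x \<in> snd c ` fst c" "y \<in> snd d ` fst d"
  shows "inv_into (fst c \<times> fst d) (map_prod (snd c) (snd d)) (x, y) = (chart_inv c x, chart_inv d y)"
proof -
  have inj: "inj_on (map_prod (snd c) (snd d)) (fst c \<times> fst d)"
    by (rule map_prod_inj_on[OF is_chart_inj is_chart_inj, OF assms(1,2)])
  show ?thesis
    using assms by (auto simp: chart_inv_snd intro!: inv_into_f_eq[OF inj])
qed

lemma is_chart_prod:
  assumes "is_chart c" "is_chart d"
  shows "is_chart (prod_chart c d)"
proof -
  have im: "map_prod (snd c) (snd d) ` (fst c \<times> fst d) = snd c ` fst c \<times> snd d ` fst d" by auto
  have "homeomorphism (fst c \<times> fst d) (snd c ` fst c \<times> snd d ` fst d) (map_prod (snd c) (snd d))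
      (map_prod (chart_inv c) (chart_inv d))"
  proof (rule homeomorphismI)
    have "continuous_on (fst c \<times> fst d) (\<lambda>x. (snd c (fst x), snd d (snd x)))"
      by (intro continuous_on_Pair continuous_on_compose2[OF is_chart_continuous]
          continuous_on_fst continuous_on_snd continuous_on_id assms) auto
    then show "continuous_on (fst c \<times> fst d) (map_prod (snd c) (snd d))"
      by (simp add: map_prod_def case_prod_beta)
    have "continuous_on (snd c ` fst c \<times> snd d ` fst d) (\<lambda>x. (chart_inv c (fst x), chart_inv d (snd x)))"
      by (intro continuous_on_Pair continuous_on_compose2[OF is_chart_continuous_inv]
          continuous_on_fst continuous_on_snd continuous_on_id assms) auto
    then show "continuous_on (snd c ` fst c \<times> snd d ` fst d) (map_prod (chart_inv c) (chart_inv d))"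
      by (simp add: map_prod_def case_prod_beta)
  qed (auto simp: chart_inv_snd[OF assms(1)] chart_inv_snd[OF assms(2)])
  then show ?thesis
    unfolding is_chart_def fst_conv snd_conv im
    using assms unfolding is_chart_def by (blast intro: open_Times)
qed

lemma prod_atlas_cases:
  assumes "e \<in> prod_atlas A B"
  obtains c d where "e = prod_chart c d" "c \<in> A" "d \<in> B"
  using assms unfolding prod_atlas_def by blast

lemma prod_chart_in_prod_atlas: "c \<in> A \<Longrightarrow> d \<in> B \<Longrightarrow> prod_chart c d \<in> prod_atlas A B"
  unfolding prod_atlas_def by blast

text \<open>The source condition is weaker than \<open>atlas A\<close> so that
  \<open>atlas_prod\<close> can take the product as source before compatibility of its charts is
  known.\<close>

lemma smooth_map_Pair:
  assumes A: "\<And>c. c \<in> A \<Longrightarrow> is_chart c" and B: "atlas B" and C: "atlas C"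
    and f: "smooth_map A B f" and g: "smooth_map A C g"
  shows "smooth_map A (prod_atlas B C) (\<lambda>x. (f x, g x))"
  unfolding smooth_map_on_def o_def
proof (intro conjI ballI)
  show cont: "continuous_on UNIV (\<lambda>x. (f x, g x))"
    by (intro continuous_on_Pair smooth_map_on_continuous[OF f] smooth_map_on_continuous[OF g])
  fix a e assume a: "a \<in> A" and "e \<in> prod_atlas B C"
  then obtain b c where bc: "e = prod_chart b c" "b \<in> B" "c \<in> C"
    using prod_atlas_cases by blast
  have chart: "is_chart a" "is_chart b" "is_chart c"
    using A B C a bc atlas_chart by blast+
  have op: "open (snd a ` (UNIV \<inter> fst a \<inter> (\<lambda>x. (f x, g x)) -` fst e))" (is "open ?U")
    by (rule open_chart_domain[OF chart(1) _ open_UNIV cont]) (simp add: bc is_chart_prod chart)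
  have "smooth_on ?U (\<lambda>y. snd b (f (chart_inv a y)))"
    by (rule smooth_on_subset[OF smooth_map_onD[OF f a bc(2)]]) (auto simp: bc(1))
  moreover have "smooth_on ?U (\<lambda>y. snd c (g (chart_inv a y)))"
    by (rule smooth_on_subset[OF smooth_map_onD[OF g a bc(3)]]) (auto simp: bc(1))
  ultimately have "smooth_on ?U (\<lambda>y. (snd b (f (chart_inv a y)), snd c (g (chart_inv a y))))"
    by (rule smooth_on_Pair[OF op])
  then show "smooth_on ?U (\<lambda>y. snd e (f (chart_inv a y), g (chart_inv a y)))"
    by (simp add: bc(1))
qed

lemma smooth_map_fst:
  fixes A :: "('m::topological_space, 'e::real_normed_vector) chart set"
    and B :: "('n::topological_space, 'f::real_normed_vector) chart set"
  assumes A: "atlas A" and B: "atlas B"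
  shows "smooth_map (prod_atlas A B) A fst"
  unfolding smooth_map_on_def o_def
proof (intro conjI ballI)
  show cont: "continuous_on UNIV (fst :: 'm \<times> 'n \<Rightarrow> 'm)"
    by (intro continuous_intros)
  fix e a' assume "e \<in> prod_atlas A B" and a': "a' \<in> A"
  then obtain a b where ab: "e = prod_chart a b" "a \<in> A" "b \<in> B"
    using prod_atlas_cases by blast
  have chart: "is_chart a" "is_chart b" "is_chart a'"
    using A B a' ab atlas_chart by blast+
  have U: "open (snd e ` (UNIV \<inter> fst e \<inter> fst -` fst a'))" (is "open ?U")
    by (rule open_chart_domain[OF _ chart(3) open_UNIV cont]) (simp add: ab is_chart_prod chart)
  have "smooth_on ?U (\<lambda>y. snd a' (chart_inv a (fst y)))"
  proof (rule smooth_on_compose[OF atlas_finite_dim[OF A] U, where f = fst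
        and T = "snd a ` (fst a \<inter> fst a')"])
    show "smooth_on ?U fst" by (rule smooth_on_bounded_linear[OF bounded_linear_fst U])
    show "smooth_on (snd a ` (fst a \<inter> fst a')) (\<lambda>y. snd a' (chart_inv a y))"
      using A a' ab(2) by (simp add: atlas_def o_def)
  qed (auto simp: ab(1))
  then show "smooth_on ?U (\<lambda>y. snd a' (fst (chart_inv e y)))"
    by (rule smooth_on_cong[OF _ U]) (auto simp: ab(1) chart_inv_prod chart)
qed

lemma smooth_map_snd:
  fixes A :: "('m::topological_space, 'e::real_normed_vector) chart set"
    and B :: "('n::topological_space, 'f::real_normed_vector) chart set"
  assumes A: "atlas A" and B: "atlas B"
  shows "smooth_map (prod_atlas A B) B snd"
  unfolding smooth_map_on_def o_def
proof (intro conjI ballI)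
  show cont: "continuous_on UNIV (snd :: 'm \<times> 'n \<Rightarrow> 'n)"
    by (intro continuous_intros)
  fix e b' assume "e \<in> prod_atlas A B" and b': "b' \<in> B"
  then obtain a b where ab: "e = prod_chart a b" "a \<in> A" "b \<in> B"
    using prod_atlas_cases by blast
  have chart: "is_chart a" "is_chart b" "is_chart b'"
    using A B b' ab atlas_chart by blast+
  have U: "open (snd e ` (UNIV \<inter> fst e \<inter> snd -` fst b'))" (is "open ?U")
    by (rule open_chart_domain[OF _ chart(3) open_UNIV cont]) (simp add: ab is_chart_prod chart)
  have "smooth_on ?U (\<lambda>y. snd b' (chart_inv b (snd y)))"
  proof (rule smooth_on_compose[OF atlas_finite_dim[OF B] U, where f = snd
        and T = "snd b ` (fst b \<inter> fst b')"])
    show "smooth_on ?U snd" by (rule smooth_on_bounded_linear[OF bounded_linear_snd U])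
    show "smooth_on (snd b ` (fst b \<inter> fst b')) (\<lambda>y. snd b' (chart_inv b y))"
      using B b' ab(3) by (simp add: atlas_def o_def)
  qed (auto simp: ab(1))
  then show "smooth_on ?U (\<lambda>y. snd b' (snd (chart_inv e y)))"
    by (rule smooth_on_cong[OF _ U]) (auto simp: ab(1) chart_inv_prod chart)
qed

text \<open>Compatibility of charts is smoothness of the identity. On a product the identity is the
  pair of the projections, which gives \<open>atlas_prod\<close>.\<close>

lemma atlas_iff_smooth_id:
  "atlas A \<longleftrightarrow> finite_dim TYPE('e) \<and> (\<forall>c\<in>A. is_chart c) \<and> (\<Union>c\<in>A. fst c) = UNIV \<and>
     smooth_map A A (\<lambda>x. x)"
  for A :: "('m::topological_space, 'e::real_normed_vector) chart set"
  by (auto simp: atlas_def smooth_map_on_def o_def vimage_def Int_def)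

lemma atlas_prod:
  fixes A :: "('m::topological_space, 'e::real_normed_vector) chart set"
    and B :: "('n::topological_space, 'f::real_normed_vector) chart set"
  assumes A: "atlas A" and B: "atlas B"
  shows "atlas (prod_atlas A B)"
  unfolding atlas_iff_smooth_id
proof (intro conjI ballI)
  show "finite_dim TYPE('e \<times> 'f)"
    by (rule finite_dim_prod[OF atlas_finite_dim[OF A] atlas_finite_dim[OF B]])
  show chart: "is_chart c" if "c \<in> prod_atlas A B" for c
  proof -
    from that obtain a b where "c = prod_chart a b" "a \<in> A" "b \<in> B" by (rule prod_atlas_cases)
    then show ?thesis using is_chart_prod[OF atlas_chart[OF A] atlas_chart[OF B]] by simp
  qed
  show "(\<Union>c\<in>prod_atlas A B. fst c) = UNIV"
  proof -
    have "\<exists>e\<in>prod_atlas A B. (x, y) \<in> fst e" for x y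
    proof -
      obtain c where c: "c \<in> A" "x \<in> fst c" by (rule atlas_cover[OF A])
      obtain d where d: "d \<in> B" "y \<in> fst d" by (rule atlas_cover[OF B])
      show ?thesis
        by (rule bexI[OF _ prod_chart_in_prod_atlas[OF c(1) d(1)]]) (use c d in simp)
    qed
    then have "p \<in> (\<Union>c\<in>prod_atlas A B. fst c)" for p by (cases p) simp
    then show ?thesis by blast
  qed
  show "smooth_map (prod_atlas A B) (prod_atlas A B) (\<lambda>x. x)"
    using smooth_map_Pair[OF chart A B smooth_map_fst[OF A B] smooth_map_snd[OF A B]] by simp
qed

lemma atlas_vs_atlas:
  assumes "finite_dim TYPE('a::real_normed_vector)"
  shows "atlas (vs_atlas :: ('a::real_normed_vector, 'a) chart set)"
proof -
  have "homeomorphism UNIV UNIV (\<lambda>x::'a. x) (\<lambda>x. x)"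
    by (auto intro!: homeomorphismI continuous_on_id)
  then have "is_chart (UNIV, \<lambda>x::'a. x)" by (auto simp: is_chart_def)
  then show ?thesis
    using assms smooth_on_bounded_linear[OF bounded_linear_ident open_UNIV]
    by (auto simp: atlas_def vs_atlas_def o_def)
qed

lemma smooth_map_vs_atlas:
  "smooth_on UNIV f \<Longrightarrow> smooth_map vs_atlas vs_atlas f"
  by (auto simp: smooth_map_on_def vs_atlas_def o_def smooth_on_def
      dest: spec[of _ 0])

lemma smooth_map_bounded_bilinear:
  fixes A :: "('m::topological_space, 'e::real_normed_vector) chart set"
    and \<beta> :: "'a::real_normed_vector \<Rightarrow> 'b::real_normed_vector \<Rightarrow> 'c::real_normed_vector"
  assumes A: "atlas A"
    and "bounded_bilinear \<beta>" and f: "smooth_map A vs_atlas f" and g: "smooth_map A vs_atlas g"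
  shows "smooth_map A vs_atlas (\<lambda>x. \<beta> (f x) (g x))"
  unfolding smooth_map_on_def o_def
proof (intro conjI ballI)
  show cont: "continuous_on UNIV (\<lambda>x. \<beta> (f x) (g x))"
    by (intro bounded_bilinear.continuous_on[OF assms(2)] smooth_map_on_continuous[OF f]
        smooth_map_on_continuous[OF g])
  fix c :: "('m, 'e) chart" and d :: "('c, 'c) chart" assume c: "c \<in> A" and "d \<in> vs_atlas"
  then have d: "d = (UNIV, \<lambda>x. x)" by (simp add: vs_atlas_def)
  have U: "open (snd c ` fst c)" using A c by (simp add: atlas_def is_chart_def)
  have "smooth_on (snd c ` fst c) (\<lambda>y. f (chart_inv c y))"
    using smooth_map_onD[OF f c, of "(UNIV, \<lambda>x. x)"] by (simp add: vs_atlas_def)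
  moreover have "smooth_on (snd c ` fst c) (\<lambda>y. g (chart_inv c y))"
    using smooth_map_onD[OF g c, of "(UNIV, \<lambda>x. x)"] by (simp add: vs_atlas_def)
  ultimately have "smooth_on (snd c ` fst c) (\<lambda>y. \<beta> (f (chart_inv c y)) (g (chart_inv c y)))"
    by (rule smooth_on_bounded_bilinear[OF assms(2) U])
  then show "smooth_on (snd c ` (UNIV \<inter> fst c \<inter> (\<lambda>x. \<beta> (f x) (g x)) -` fst d))
      (\<lambda>y. snd d (\<beta> (f (chart_inv c y)) (g (chart_inv c y))))"
    by (simp add: d)
qed

section \<open>Tangent maps, and maps with vanishing derivative\<close>

lemma smooth_map_differentiable_chart:
  assumes "smooth_map A B f" "c \<in> charts_at A p" "d \<in> charts_at B (f p)"
  shows "((\<lambda>y. snd d (f (chart_inv c y))) has_derivative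
    frechet_derivative (\<lambda>y. snd d (f (chart_inv c y))) (at (snd c p))) (at (snd c p))"
  using assms smooth_on_differentiable[OF smooth_map_onD[OF assms(1)], of c d "snd c p"]
  by (auto simp: charts_at_def frechet_derivative_works[symmetric])

text \<open>\<open>tangent_map\<close> computes in a chart picked by choice; the transformation law
  in \<open>tangent_space\<close> and the chain rule give the same result in every chart.\<close>

lemma tangent_map_chart:
  assumes A: "atlas A" and f: "smooth_map A B f"
    and \<xi>: "\<xi> \<in> tangent_space A p" and c: "c \<in> charts_at A p" and d: "d \<in> charts_at B (f p)"
  shows "tangent_map A B f p \<xi> d =
    frechet_derivative (\<lambda>y. snd d (f (chart_inv c y))) (at (snd c p)) (\<xi> c)"
proof -
  define c0 where "c0 = (SOME c. c \<in> charts_at A p)"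
  have c0: "c0 \<in> charts_at A p" unfolding c0_def using c by (rule someI)
  have "c \<in> A" "c0 \<in> A" using c c0 by (auto simp: charts_at_def)
  note this[THEN atlas_chart[OF A]]
  moreover have "p \<in> fst c" "p \<in> fst c0" using c c0 by (auto simp: charts_at_def)
  ultimately have chart: "is_chart c" "is_chart c0" "p \<in> fst c" "p \<in> fst c0" by blast+
  have "((\<lambda>y. snd d (f (chart_inv c0 y))) has_derivative
      (\<lambda>v. frechet_derivative (\<lambda>y. snd d (f (chart_inv c y))) (at (snd c p))
        (frechet_derivative (\<lambda>y. snd c (chart_inv c0 y)) (at (snd c0 p)) v))) (at (snd c0 p))"
  proof (rule chain_through_chart[OF chart(1) continuous_at_chart_inv[OF chart(2,4)]])
    show "((\<lambda>y. snd c (chart_inv c0 y)) has_derivative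
        frechet_derivative (\<lambda>y. snd c (chart_inv c0 y)) (at (snd c0 p))) (at (snd c0 p))"
      by (rule smooth_map_differentiable_chart[OF smooth_map_id[OF A] c0 c])
    show "((\<lambda>z. snd d (f (chart_inv c z))) has_derivative
        frechet_derivative (\<lambda>y. snd d (f (chart_inv c y))) (at (snd c p)))
        (at (snd c (chart_inv c0 (snd c0 p))))"
      unfolding chart_inv_snd[OF chart(2,4)] by (rule smooth_map_differentiable_chart[OF f c d])
  qed (simp add: chart_inv_snd chart)
  from frechet_derivative_at[OF this]
  have "frechet_derivative (\<lambda>y. snd d (f (chart_inv c0 y))) (at (snd c0 p)) (\<xi> c0) =
      frechet_derivative (\<lambda>y. snd d (f (chart_inv c y))) (at (snd c p))
        (frechet_derivative (\<lambda>y. snd c (chart_inv c0 y)) (at (snd c0 p)) (\<xi> c0))"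
    by (rule fun_cong[OF sym])
  moreover have "\<xi> c = frechet_derivative (\<lambda>y. snd c (chart_inv c0 y)) (at (snd c0 p)) (\<xi> c0)"
    using \<xi> c c0 unfolding tangent_space_def o_def by blast
  moreover have "tangent_map A B f p \<xi> d =
      frechet_derivative (\<lambda>y. snd d (f (chart_inv c0 y))) (at (snd c0 p)) (\<xi> c0)"
    using d by (simp add: tangent_map_def c0_def o_def Let_def)
  ultimately show ?thesis by simp
qed

text \<open>On a ball in a chart, a convex set, zero derivative makes the coordinates of
  \<open>f\<close> constant. So \<open>f\<close> is locally constant, and connectedness does the
  rest.\<close>

lemma zero_derivative_imp_constant:
  fixes f :: "'m::topological_space \<Rightarrow> 'n::topological_space"
    and A :: "('m, 'e::real_normed_vector) chart set" and B :: "('n, 'f::real_normed_vector) chart set"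
  assumes A: "atlas A" and B: "atlas B" and "connected (UNIV :: 'm set)"
    and f: "continuous_on UNIV f"
    and zero: "\<And>p c d. c \<in> charts_at A p \<Longrightarrow> d \<in> charts_at B (f p) \<Longrightarrow>
      ((\<lambda>y. snd d (f (chart_inv c y))) has_derivative (\<lambda>_. 0)) (at (snd c p))"
  shows "f p = f q"
proof (rule connected_local_const[OF assms(3) UNIV_I UNIV_I], intro ballI)
  fix a :: 'm
  obtain c where c: "c \<in> A" "a \<in> fst c" by (rule atlas_cover[OF A])
  obtain d where d: "d \<in> B" "f a \<in> fst d" by (rule atlas_cover[OF B])
  have chart: "is_chart c" "is_chart d" using A B c d atlas_chart by blast+
  have "open (UNIV \<inter> f -` fst d)"
    by (rule continuous_open_preimage[OF f open_UNIV is_chart_open[OF chart(2)]])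
  then have "open (f -` fst d)" by simp
  from is_chart_open_image[OF chart(1) this] have "open (snd c ` (f -` fst d \<inter> fst c))" .
  \<comment> \<open>The ball is so small that \<open>f\<close> sends all of it into
    \<open>fst d\<close>, where equal coordinates mean equal points.\<close>
  then obtain r where r: "r > 0" "ball (snd c a) r \<subseteq> snd c ` (f -` fst d \<inter> fst c)"
    using c d by (meson openE image_eqI IntI vimageI2)
  define F where "F y = snd d (f (chart_inv c y))" for y
  have F0: "(F has_derivative (\<lambda>_. 0)) (at y within ball (snd c a) r)" if y: "y \<in> ball (snd c a) r" for y
  proof -
    obtain p where p: "y = snd c p" "p \<in> fst c" "f p \<in> fst d" using r y by blast
    have "(F has_derivative (\<lambda>_. 0)) (at y)"
      unfolding F_def p(1) by (rule zero) (use c d p in \<open>auto simp: charts_at_def\<close>)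
    then show ?thesis by (rule has_derivative_at_withinI)
  qed
  define N where "N = fst c \<inter> snd c -` ball (snd c a) r"
  have "open N" unfolding N_def
    by (rule continuous_open_preimage[OF is_chart_continuous is_chart_open]) (use chart in auto)
  moreover have "a \<in> N" using c r by (simp add: N_def)
  moreover have "f a = f b" if "b \<in> N" for b
  proof -
    have b: "b \<in> fst c" "snd c b \<in> ball (snd c a) r" using that by (auto simp: N_def)
    then obtain p where p: "snd c b = snd c p" "p \<in> fst c" "f p \<in> fst d" using r by blast
    have "p = b" using p b chart_inv_snd[OF chart(1)] by metis
    have "F (snd c a) = F (snd c b)"
      by (rule has_derivative_zero_unique[OF convex_ball F0]) (use b r in auto)
    then have "snd d (f a) = snd d (f b)"
      using b c by (simp add: F_def chart_inv_snd[OF chart(1)])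
    then show ?thesis
      using p \<open>p = b\<close> d chart_inv_snd[OF chart(2)] by metis
  qed
  ultimately show "\<forall>\<^sub>F b in at a within UNIV. f a = f b"
    unfolding eventually_at_topological by blast
qed

lemma transition_chain:
  assumes A: "atlas A" and c: "c \<in> charts_at A p" "c' \<in> charts_at A p"
    and e: "e \<in> charts_at A p"
  shows "frechet_derivative (\<lambda>y. snd e (chart_inv c y)) (at (snd c p)) v =
    frechet_derivative (\<lambda>y. snd e (chart_inv c' y)) (at (snd c' p))
      (frechet_derivative (\<lambda>y. snd c' (chart_inv c y)) (at (snd c p)) v)"
proof -
  have chart: "is_chart c" "is_chart c'" "p \<in> fst c" "p \<in> fst c'"
    using c atlas_chart[OF A] by (simp_all add: charts_at_def)
  have "((\<lambda>y. snd e (chart_inv c y)) has_derivative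
      (\<lambda>v. frechet_derivative (\<lambda>y. snd e (chart_inv c' y)) (at (snd c' p))
        (frechet_derivative (\<lambda>y. snd c' (chart_inv c y)) (at (snd c p)) v))) (at (snd c p))"
  proof (rule chain_through_chart[OF chart(2) continuous_at_chart_inv[OF chart(1,3)],
        where h = "snd e" and D = "frechet_derivative (\<lambda>y. snd c' (chart_inv c y)) (at (snd c p))"
        and E = "frechet_derivative (\<lambda>y. snd e (chart_inv c' y)) (at (snd c' p))"])
    show "((\<lambda>y. snd c' (chart_inv c y)) has_derivative
        frechet_derivative (\<lambda>y. snd c' (chart_inv c y)) (at (snd c p))) (at (snd c p))"
      by (rule smooth_map_differentiable_chart[OF smooth_map_id[OF A] c])
    show "((\<lambda>z. snd e (chart_inv c' z)) has_derivative
        frechet_derivative (\<lambda>y. snd e (chart_inv c' y)) (at (snd c' p)))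
        (at (snd c' (chart_inv c (snd c p))))"
      unfolding chart_inv_snd[OF chart(1,3)]
      by (rule smooth_map_differentiable_chart[OF smooth_map_id[OF A] c(2) e])
  qed (simp add: chart_inv_snd chart)
  from fun_cong[OF frechet_derivative_at[OF this]] show ?thesis by simp
qed

text \<open>The vector \<open>v\<close> is pushed from \<open>d\<close> to every chart by the
  transition derivative; the cocycle rule \<open>transition_chain\<close> makes the family
  consistent.\<close>

lemma tangent_vector_exists:
  assumes A: "atlas A" and d: "d \<in> charts_at A p"
  obtains \<zeta> where "\<zeta> \<in> tangent_space A p" "\<zeta> d = v"
proof
  let ?\<zeta> = "\<lambda>c. if c \<in> charts_at A p
    then frechet_derivative (\<lambda>y. snd c (chart_inv d y)) (at (snd d p)) v else 0"
  show "?\<zeta> \<in> tangent_space A p"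
    unfolding tangent_space_def o_def
  proof (intro CollectI conjI ballI allI impI)
    fix c c' assume c: "c \<in> charts_at A p" "c' \<in> charts_at A p"
    show "?\<zeta> c' = frechet_derivative (\<lambda>y. snd c' (chart_inv c y)) (at (snd c p)) (?\<zeta> c)"
      unfolding if_P[OF c(1)] if_P[OF c(2)] by (rule transition_chain[OF A d c])
  qed simp
  have chart: "is_chart d" "p \<in> fst d" using d atlas_chart[OF A] by (simp_all add: charts_at_def)
  have "((\<lambda>y. snd d (chart_inv d y)) has_derivative (\<lambda>v. v)) (at (snd d p))"
    by (rule has_derivative_transform_within_open[OF has_derivative_ident, of "snd d ` fst d"])
      (use chart in \<open>auto simp: is_chart_def f_inv_into_f\<close>)
  from fun_cong[OF frechet_derivative_at[OF this], of v] show "?\<zeta> d = v" using d by simp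
qed

text \<open>Transport of a critical point: with translations as \<open>j\<close> and
  \<open>k\<close>, a zero derivative of \<open>F\<close> at one point spreads to all
  points.\<close>

lemma zero_derivative_compose:
  fixes M :: "('m::t2_space, 'a::real_normed_vector) chart set"
    and M' :: "('n::t2_space, 'b::real_normed_vector) chart set"
    and N :: "('k::t2_space, 'c::real_normed_vector) chart set"
    and N' :: "('l::t2_space, 'd::real_normed_vector) chart set"
  assumes M': "atlas M'" and N: "atlas N" and M: "atlas M"
    and j: "smooth_map M M' j" and F: "smooth_map M' N F" and k: "smooth_map N N' k"
    and c: "c \<in> charts_at M p" and a: "a \<in> charts_at M' (j p)"
    and b: "b \<in> charts_at N (F (j p))" and e: "e \<in> charts_at N' (k (F (j p)))"
    and zero: "((\<lambda>y. snd b (F (chart_inv a y))) has_derivative (\<lambda>_. 0)) (at (snd a (j p)))"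
  shows "((\<lambda>y. snd e (k (F (j (chart_inv c y))))) has_derivative (\<lambda>_. 0)) (at (snd c p))"
proof -
  have chart: "is_chart c" "is_chart a" "is_chart b" "p \<in> fst c" "j p \<in> fst a" "F (j p) \<in> fst b"
    using a b c atlas_chart[OF M] atlas_chart[OF M'] atlas_chart[OF N] by (simp_all add: charts_at_def)
  have p: "chart_inv c (snd c p) = p" by (rule chart_inv_snd[OF chart(1,4)])
  note cont_c = continuous_at_chart_inv[OF chart(1,4)]
  have cont_j: "continuous (at (snd c p)) (\<lambda>y. j (chart_inv c y))"
    by (rule isCont_o2[OF cont_c smooth_map_continuous_at[OF j]])
  have cont_F: "continuous (at (snd c p)) (\<lambda>y. F (j (chart_inv c y)))"
    by (rule isCont_o2[OF cont_j smooth_map_continuous_at[OF F]])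
  have "((\<lambda>y. snd b (F (j (chart_inv c y)))) has_derivative (\<lambda>_. 0)) (at (snd c p))"
    by (rule chain_through_chart[OF chart(2) cont_j _ smooth_map_differentiable_chart[OF j c a]])
      (simp_all add: p chart zero)
  from chain_through_chart[OF chart(3) cont_F _ this, of "\<lambda>z. snd e (k z)"]
    smooth_map_differentiable_chart[OF k b e]
  have "((\<lambda>y. snd e (k (F (j (chart_inv c y))))) has_derivative
      (\<lambda>v. frechet_derivative (\<lambda>y. snd e (k (chart_inv b y))) (at (snd b (F (j p)))) 0)) (at (snd c p))"
    by (simp add: p chart)
  moreover have "frechet_derivative (\<lambda>y. snd e (k (chart_inv b y))) (at (snd b (F (j p)))) 0 = 0"
    using smooth_map_differentiable_chart[OF k b e] has_derivative_linear linear_0 by blast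
  ultimately show ?thesis by simp
qed

section \<open>The Lie algebra of a Lie group in a chart\<close>

text \<open>The chart is a parameter and not a choice, so that every result can be instantiated at
  each chart around the identity.\<close>

locale lie_group_chart =
  fixes A :: "('g::{t2_space, second_countable_topology}, 'e::real_normed_vector) chart set"
    and G :: "'g monoid" (structure)
    and d :: "('g, 'e) chart"
  assumes lie: "lie_group A G" and d: "d \<in> charts_at A \<one>"
begin

sublocale group G
  using lie by (simp add: lie_group_def)

lemma carrier_UNIV [simp]: "carrier G = UNIV"
  using lie by (simp add: lie_group_def)

lemma atlas: "atlas A"
  using lie by (simp add: lie_group_def smooth_manifold_atlas)

lemma atlas2: "atlas (prod_atlas A A)"
  by (rule atlas_prod[OF atlas atlas])

lemma fin_dim: "finite_dim TYPE('e)"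
  by (rule atlas_finite_dim[OF atlas])

lemma chart: "is_chart d" and one_in_chart: "\<one> \<in> fst d"
  using d atlas_chart[OF atlas] by (simp_all add: charts_at_def)

lemma inv_mult [simp]: "inv (x \<otimes> y) = inv y \<otimes> inv x"
  by (simp add: inv_mult_group)

lemma inv_cancel [simp]:
  "inv x \<otimes> (x \<otimes> y) = y" "x \<otimes> (inv x \<otimes> y) = y"
  by (simp_all add: m_assoc[symmetric])

lemma smooth_mult:
  assumes "atlas M" "smooth_map M A f" "smooth_map M A g"
  shows "smooth_map M A (\<lambda>x. f x \<otimes> g x)"
proof -
  have "smooth_map (prod_atlas A A) A (\<lambda>(x, y). x \<otimes> y)"
    using lie by (simp add: lie_group_def)
  from smooth_map_on_compose[OF assms(1) atlas2 atlas open_UNIV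
      smooth_map_Pair[OF atlas_chart[OF assms(1)] atlas atlas assms(2,3)] this]
  show ?thesis by simp
qed

lemma smooth_inv:
  assumes "atlas M" "smooth_map M A f"
  shows "smooth_map M A (\<lambda>x. inv (f x))"
proof -
  have "smooth_map A A (\<lambda>x. inv x)" using lie by (simp add: lie_group_def)
  from smooth_map_on_compose[OF assms(1) atlas atlas open_UNIV assms(2) this] show ?thesis .
qed

section \<open>Multiplication in coordinates around the identity\<close>

abbreviation "\<phi> \<equiv> snd d"
abbreviation "\<psi> \<equiv> chart_inv d"
abbreviation "U \<equiv> \<phi> ` fst d"
abbreviation "e0 \<equiv> \<phi> \<one>"

lemma open_U: "open U"
  using chart by (simp add: is_chart_def)

lemma e0_in_U: "e0 \<in> U"
  using one_in_chart by simp

lemma \<psi>\<phi>: "x \<in> fst d \<Longrightarrow> \<psi> (\<phi> x) = x"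
  by (rule chart_inv_snd[OF chart])

lemma \<psi>_e0 [simp]: "\<psi> e0 = \<one>"
  by (rule \<psi>\<phi>[OF one_in_chart])

text \<open>General in \<open>F\<close> to serve both multiplication and conjugation. With a pair as
  argument, both partial derivatives are values of one Frechet derivative.\<close>

definition coord :: "('g \<Rightarrow> 'g \<Rightarrow> 'g) \<Rightarrow> 'e \<times> 'e \<Rightarrow> 'e" where
  "coord F z = \<phi> (F (\<psi> (fst z)) (\<psi> (snd z)))"

definition coord_dom :: "('g \<Rightarrow> 'g \<Rightarrow> 'g) \<Rightarrow> ('e \<times> 'e) set" where
  "coord_dom F = {(x, y). x \<in> U \<and> y \<in> U \<and> F (\<psi> x) (\<psi> y) \<in> fst d}"

lemma coord_smooth:
  assumes "smooth_map (prod_atlas A A) A (\<lambda>(x, y). F x y)"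
  shows "open (coord_dom F)" "smooth_on (coord_dom F) (coord F)"
proof -
  let ?c = "prod_chart d d"
  have dA: "d \<in> A" using d by (simp add: charts_at_def)
  have c: "?c \<in> prod_atlas A A" by (rule prod_chart_in_prod_atlas[OF dA dA])
  have dom: "coord_dom F = snd ?c ` (UNIV \<inter> fst ?c \<inter> (\<lambda>(x, y). F x y) -` fst d)"
    by (auto simp: coord_dom_def \<psi>\<phi> image_iff)
  show op: "open (coord_dom F)"
    unfolding dom
    by (rule open_chart_domain[OF is_chart_prod[OF chart chart] chart open_UNIV
          smooth_map_on_continuous[OF assms]])
  have "smooth_on (coord_dom F) (\<lambda>y. \<phi> (case chart_inv ?c y of (x, y) \<Rightarrow> F x y))"
    unfolding dom by (rule smooth_map_onD[OF assms c dA])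
  then show "smooth_on (coord_dom F) (coord F)"
    by (rule smooth_on_cong[OF _ op])
      (auto simp: coord_dom_def coord_def chart_inv_prod[OF chart chart])
qed

lemma coord_derivative:
  assumes "smooth_map (prod_atlas A A) A (\<lambda>(x, y). F x y)" "z \<in> coord_dom F"
  shows "(coord F has_derivative frechet_derivative (coord F) (at z)) (at z)"
  using smooth_on_differentiable[OF coord_smooth(2)[OF assms(1)] assms(2)] frechet_derivative_works
  by blast

lemma coord_partial1:
  assumes "smooth_map (prod_atlas A A) A (\<lambda>(x, y). F x y)" "(x, y) \<in> coord_dom F"
  shows "((\<lambda>x. coord F (x, y)) has_derivative
    (\<lambda>u. frechet_derivative (coord F) (at (x, y)) (u, 0))) (at x)"
  by (rule has_derivative_fst_partial[OF coord_derivative[OF assms]])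

lemma coord_partial2:
  assumes "smooth_map (prod_atlas A A) A (\<lambda>(x, y). F x y)" "(x, y) \<in> coord_dom F"
  shows "((\<lambda>y. coord F (x, y)) has_derivative
    (\<lambda>v. frechet_derivative (coord F) (at (x, y)) (0, v))) (at y)"
  by (rule has_derivative_snd_partial[OF coord_derivative[OF assms]])

lemma coord_second:
  assumes "smooth_map (prod_atlas A A) A (\<lambda>(x, y). F x y)" "z \<in> coord_dom F"
  shows "((\<lambda>z. frechet_derivative (coord F) (at z) w) has_derivative
    frechet_derivative (\<lambda>z. frechet_derivative (coord F) (at z) w) (at z)) (at z)"
  using smooth_on_differentiable[OF smooth_on_frechet_derivative[OF coord_smooth(2)[OF assms(1)]] assms(2)]
    frechet_derivative_works by blast

lemma smooth_mult2: "smooth_map (prod_atlas A A) A (\<lambda>(x, y). x \<otimes> y)"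
  using lie by (simp add: lie_group_def)

abbreviation "m \<equiv> coord (\<otimes>)"
abbreviation "Dm \<equiv> \<lambda>z. frechet_derivative m (at z)"

lemma m_dom: "x \<in> U \<Longrightarrow> (x, e0) \<in> coord_dom (\<otimes>)" "x \<in> U \<Longrightarrow> (e0, x) \<in> coord_dom (\<otimes>)"
  by (auto simp: coord_dom_def \<psi>\<phi> one_in_chart)

text \<open>The right unit law differentiated in \<open>x\<close>; the left one gives
  \<open>Dm_left_one\<close>.\<close>

lemma Dm_right_one:
  assumes "x \<in> U"
  shows "Dm (x, e0) (u, 0) = u"
proof -
  have "((\<lambda>x. m (x, e0)) has_derivative (\<lambda>u. u)) (at x)"
    by (rule has_derivative_transform_within_open[OF has_derivative_ident open_U assms])
      (auto simp: coord_def \<psi>\<phi>)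
  from fun_cong[OF has_derivative_unique[OF coord_partial1[OF smooth_mult2 m_dom(1)[OF assms]] this]]
  show ?thesis .
qed

lemma Dm_left_one:
  assumes "x \<in> U"
  shows "Dm (e0, x) (0, v) = v"
proof -
  have "((\<lambda>x. m (e0, x)) has_derivative (\<lambda>u. u)) (at x)"
    by (rule has_derivative_transform_within_open[OF has_derivative_ident open_U assms])
      (auto simp: coord_def \<psi>\<phi>)
  from fun_cong[OF has_derivative_unique[OF coord_partial2[OF smooth_mult2 m_dom(2)[OF assms]] this]]
  show ?thesis .
qed

text \<open>The derivative is the sum of its partials, which the unit laws supply: to first order
  multiplication is addition.\<close>

lemma m_derivative: "(m has_derivative (\<lambda>w. fst w + snd w)) (at (e0, e0))"
proof -
  note D = coord_derivative[OF smooth_mult2 m_dom(1)[OF e0_in_U]]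
  have "Dm (e0, e0) w = fst w + snd w" for w
    using linear_add[OF has_derivative_linear[OF D], of "(fst w, 0)" "(0, snd w)"]
    by (simp add: Dm_right_one Dm_left_one e0_in_U)
  then have "Dm (e0, e0) = (\<lambda>w. fst w + snd w)" by (rule ext)
  with D show ?thesis by simp
qed

lemma mult_has_derivative:
  fixes f g :: "'a::real_normed_vector \<Rightarrow> 'g"
  assumes "continuous (at x) f" "continuous (at x) g" "f x = \<one>" "g x = \<one>"
    and "((\<lambda>y. \<phi> (f y)) has_derivative D) (at x)" "((\<lambda>y. \<phi> (g y)) has_derivative E) (at x)"
  shows "((\<lambda>y. \<phi> (f y \<otimes> g y)) has_derivative (\<lambda>v. D v + E v)) (at x)"
proof -
  obtain V where V: "open V" "x \<in> V" "f ` V \<subseteq> fst d"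
    using continuous_at_preimage_open[OF assms(1) is_chart_open[OF chart]] assms(3) one_in_chart by auto
  obtain W where W: "open W" "x \<in> W" "g ` W \<subseteq> fst d"
    using continuous_at_preimage_open[OF assms(2) is_chart_open[OF chart]] assms(4) one_in_chart by auto
  have "((\<lambda>y. m (\<phi> (f y), \<phi> (g y))) has_derivative (\<lambda>v. fst (D v, E v) + snd (D v, E v))) (at x)"
    by (rule has_derivative_compose[OF has_derivative_Pair[OF assms(5,6)]])
      (simp add: assms(3,4) m_derivative)
  then have "((\<lambda>y. m (\<phi> (f y), \<phi> (g y))) has_derivative (\<lambda>v. D v + E v)) (at x)" by simp
  then show ?thesis
    by (rule has_derivative_transform_within_open[of _ _ _ _ "V \<inter> W"])
      (use V W in \<open>auto simp: coord_def image_subset_iff \<psi>\<phi>\<close>)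
qed

text \<open>The mixed second derivative of multiplication at the identity, the mixed bilinear term
  of its Taylor expansion. Its antisymmetrization \<open>B2 u v - B2 v u\<close> is the Lie
  bracket.\<close>

definition B2 :: "'e \<Rightarrow> 'e \<Rightarrow> 'e" where
  "B2 u v = frechet_derivative (\<lambda>z. Dm z (0, v)) (at (e0, e0)) (u, 0)"

lemma Dm_has_derivative_left: "((\<lambda>x. Dm (x, e0) (0, w)) has_derivative (\<lambda>h. B2 h w)) (at e0)"
  unfolding B2_def
  by (rule has_derivative_fst_partial[OF coord_second[OF smooth_mult2 m_dom(1)[OF e0_in_U]]])

text \<open>\<open>B2\<close> is built from the partial derivative in the second variable. Symmetry
  of second derivatives makes it also the derivative of the partial in the first.\<close>

lemma Dm_has_derivative_right: "((\<lambda>x. Dm (e0, x) (u, 0)) has_derivative (\<lambda>h. B2 u h)) (at e0)"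
proof -
  note dom = m_dom(1)[OF e0_in_U]
  have sym: "frechet_derivative (\<lambda>z. Dm z (u, 0)) (at (e0, e0)) (0, h) = B2 u h" for h
    unfolding B2_def
    by (rule symmetric_second_derivative[OF coord_smooth(1)[OF smooth_mult2] dom
          smooth_on_differentiable[OF coord_smooth(2)[OF smooth_mult2]]
          coord_second[OF smooth_mult2 dom] coord_second[OF smooth_mult2 dom]])
  have "((\<lambda>x. Dm (e0, x) (u, 0)) has_derivative
      (\<lambda>h. frechet_derivative (\<lambda>z. Dm z (u, 0)) (at (e0, e0)) (0, h))) (at e0)"
    by (rule has_derivative_snd_partial[OF coord_second[OF smooth_mult2 dom]])
  then show ?thesis by (simp add: sym)
qed

lemma smooth_translation: "smooth_map A A (\<lambda>x. g \<otimes> x)"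
  by (rule smooth_mult[OF atlas smooth_map_const smooth_map_id[OF atlas]])

text \<open>Left translation by \<open>\<psi> x\<close> is a partial map of \<open>m\<close>, so the
  field becomes a partial derivative of \<open>m\<close> that can be differentiated again.\<close>

lemma left_inv_field_coord:
  assumes "\<xi> \<in> tangent_space A \<one>" "x \<in> U"
  shows "left_inv_field A G \<xi> (\<psi> x) d = Dm (x, e0) (0, \<xi> d)"
proof -
  have "d \<in> charts_at A (\<psi> x \<otimes> \<one>)"
    using assms(2) d by (auto simp: charts_at_def \<psi>\<phi>)
  from tangent_map_chart[OF atlas smooth_translation assms(1) d this]
  have "left_inv_field A G \<xi> (\<psi> x) d = frechet_derivative (\<lambda>y. \<phi> (\<psi> x \<otimes> \<psi> y)) (at e0) (\<xi> d)"
    by (simp add: left_inv_field_def)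
  also have "\<dots> = Dm (x, e0) (0, \<xi> d)"
    using fun_cong[OF frechet_derivative_at[OF coord_partial2[OF smooth_mult2 m_dom(1)[OF assms(2)]]]]
    by (simp add: coord_def)
  finally show ?thesis .
qed

text \<open>In direction \<open>h\<close> the field of \<open>\<eta>\<close> has derivative
  \<open>B2 h (\<eta> d)\<close> at the identity; the sign convention of
  \<open>field_bracket\<close> puts the derivative along \<open>\<xi>\<close> first.\<close>

lemma lie_bracket_coord:
  assumes "\<xi> \<in> tangent_space A \<one>" "\<eta> \<in> tangent_space A \<one>"
  shows "lie_bracket A G \<xi> \<eta> d = B2 (\<xi> d) (\<eta> d) - B2 (\<eta> d) (\<xi> d)"
proof -
  have der: "frechet_derivative (\<lambda>x. left_inv_field A G \<zeta> (\<psi> x) d) (at e0) h = B2 h (\<zeta> d)"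
    if "\<zeta> \<in> tangent_space A \<one>" for \<zeta> h
  proof -
    have "((\<lambda>x. left_inv_field A G \<zeta> (\<psi> x) d) has_derivative (\<lambda>h. B2 h (\<zeta> d))) (at e0)"
      by (rule has_derivative_transform_within_open[OF Dm_has_derivative_left open_U e0_in_U])
        (rule left_inv_field_coord[OF that, symmetric])
    from fun_cong[OF frechet_derivative_at[OF this]] show ?thesis by simp
  qed
  have one: "left_inv_field A G \<zeta> \<one> d = \<zeta> d" if "\<zeta> \<in> tangent_space A \<one>" for \<zeta>
    using left_inv_field_coord[OF that e0_in_U] by (simp add: Dm_left_one e0_in_U)
  show ?thesis
    using d by (simp add: lie_bracket_def field_bracket_def der one assms)
qed

section \<open>The adjoint action\<close>

definition conjugate :: "'g \<Rightarrow> 'g \<Rightarrow> 'g" where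
  "conjugate g y = inv g \<otimes> y \<otimes> g"

text \<open>In the usual convention this is the adjoint action of the inverse of \<open>g\<close>,
  hence a right action, as the rack operation requires.\<close>

definition Ad :: "'g \<Rightarrow> 'e \<Rightarrow> 'e" where
  "Ad g = frechet_derivative (\<lambda>y. \<phi> (conjugate g (\<psi> y))) (at e0)"

lemma conjugate_one [simp]: "conjugate g \<one> = \<one>" "conjugate \<one> y = y"
  by (simp_all add: conjugate_def)

lemma conjugate_mult: "conjugate (g \<otimes> h) y = conjugate h (conjugate g y)"
  by (simp add: conjugate_def m_assoc)

lemma smooth_conjugate: "smooth_map A A (conjugate g)"
  unfolding conjugate_def
  by (intro smooth_mult[OF atlas] smooth_map_const smooth_map_id[OF atlas])

lemma smooth_conjugate2: "smooth_map (prod_atlas A A) A (\<lambda>(y, x). conjugate x y)"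
proof -
  have "smooth_map (prod_atlas A A) A (\<lambda>z. inv (snd z) \<otimes> fst z \<otimes> snd z)"
    by (intro smooth_mult[OF atlas2] smooth_inv[OF atlas2] smooth_map_fst smooth_map_snd atlas)
  then show ?thesis by (simp add: conjugate_def case_prod_unfold)
qed

lemma Ad_has_derivative: "((\<lambda>y. \<phi> (conjugate g (\<psi> y))) has_derivative Ad g) (at e0)"
  unfolding Ad_def by (rule smooth_map_differentiable_chart[OF smooth_conjugate d]) (simp add: d)

lemma continuous_at_\<psi>: "continuous (at e0) \<psi>"
  by (rule continuous_at_chart_inv[OF chart one_in_chart])

lemma continuous_at_compose_\<psi>:
  assumes "smooth_map A B f"
  shows "continuous (at e0) (\<lambda>y. f (\<psi> y))"
  by (rule isCont_o2[OF continuous_at_\<psi> smooth_map_continuous_at[OF assms]])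

lemma Ad_mult: "Ad (g \<otimes> h) u = Ad h (Ad g u)"
proof -
  have "((\<lambda>y. \<phi> (conjugate h (conjugate g (\<psi> y)))) has_derivative (\<lambda>u. Ad h (Ad g u))) (at e0)"
    by (rule chain_through_chart[OF chart continuous_at_compose_\<psi>[OF smooth_conjugate] _ Ad_has_derivative])
      (simp_all add: one_in_chart Ad_has_derivative)
  from fun_cong[OF frechet_derivative_at[OF this]] show ?thesis
    by (simp add: Ad_def[of "g \<otimes> h"] conjugate_mult)
qed

lemma Ad_one [simp]: "Ad \<one> u = u"
proof -
  have "((\<lambda>y. \<phi> (conjugate \<one> (\<psi> y))) has_derivative (\<lambda>u. u)) (at e0)"
    by (rule has_derivative_transform_within_open[OF has_derivative_ident open_U e0_in_U])
      (auto simp: \<psi>\<phi>)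
  from fun_cong[OF frechet_derivative_at[OF this]] show ?thesis by (simp add: Ad_def)
qed

text \<open>Differentiate \<open>x (x\<inverse> y x) = y x\<close> first in \<open>y\<close> at the identity, then in \<open>x\<close>.\<close>

lemma Ad_coord_derivative: "((\<lambda>x. Ad (\<psi> x) u) has_derivative (\<lambda>h. B2 u h - B2 h u)) (at e0)"
proof -
  let ?C = "\<lambda>y x. conjugate x y"
  have dom: "(e0, x) \<in> coord_dom ?C" if "x \<in> U" for x
    using that by (auto simp: coord_dom_def one_in_chart)
  have Ad_C: "frechet_derivative (coord ?C) (at (e0, x)) (u, 0) = Ad (\<psi> x) u" if "x \<in> U" for x
    using fun_cong[OF frechet_derivative_at[OF coord_partial1[OF smooth_conjugate2 dom[OF that]]]]
    by (simp add: coord_def Ad_def)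
  \<comment> \<open>Smoothness of conjugation only says that a derivative exists; its value is
    solved for at the end from the two ways to differentiate \<open>eq\<close>.\<close>
  obtain a' where "((\<lambda>x. frechet_derivative (coord ?C) (at (e0, x)) (u, 0)) has_derivative a') (at e0)"
    using has_derivative_snd_partial[OF coord_second[OF smooth_conjugate2 dom[OF e0_in_U]]] by blast
  then have a': "((\<lambda>x. Ad (\<psi> x) u) has_derivative a') (at e0)"
    by (rule has_derivative_transform_within_open[OF _ open_U e0_in_U Ad_C])
  have eq: "Dm (x, e0) (0, Ad (\<psi> x) u) = Dm (e0, x) (u, 0)" if x: "x \<in> U" for x
  proof -
    \<comment> \<open>A neighbourhood of \<open>e0\<close> on which conjugate and product stay in
      the chart, so that \<open>\<psi>\<close> undoes \<open>\<phi>\<close> on the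
      conjugate.\<close>
    let ?V = "(\<lambda>y. (y, x)) -` (coord_dom ?C \<inter> coord_dom (\<otimes>))"
    have V: "open ?V"
      by (intro open_vimage open_Int coord_smooth(1) smooth_conjugate2 smooth_mult2 continuous_intros)
    have e0_V: "e0 \<in> ?V" using dom[OF x] m_dom(2)[OF x] by simp
    have "((\<lambda>y. m (x, \<phi> (conjugate (\<psi> x) (\<psi> y)))) has_derivative (\<lambda>u. Dm (x, e0) (0, Ad (\<psi> x) u))) (at e0)"
      by (rule has_derivative_compose[OF Ad_has_derivative])
        (simp add: coord_partial2[OF smooth_mult2 m_dom(1)[OF x]])
    then have "((\<lambda>y. m (y, x)) has_derivative (\<lambda>u. Dm (x, e0) (0, Ad (\<psi> x) u))) (at e0)"
    proof (rule has_derivative_transform_within_open[OF _ V e0_V])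
      fix y assume "y \<in> ?V"
      then show "m (x, \<phi> (conjugate (\<psi> x) (\<psi> y))) = m (y, x)"
        by (simp add: coord_dom_def coord_def \<psi>\<phi>) (simp add: conjugate_def m_assoc)
    qed
    from fun_cong[OF has_derivative_unique[OF this coord_partial1[OF smooth_mult2 m_dom(2)[OF x]]]]
    show ?thesis .
  qed
  have "((\<lambda>x. Dm (x, e0) (0, Ad (\<psi> x) u)) has_derivative
      (\<lambda>h. B2 h (Ad (\<psi> e0) u) + Dm (e0, e0) (0, a' h))) (at e0)"
  proof (rule has_derivative_linear_family[OF fin_dim open_U e0_in_U _ Dm_has_derivative_left a'])
    fix x assume x: "x \<in> U"
    show "linear (\<lambda>w. Dm (x, e0) (0, w))"
      using coord_partial2[OF smooth_mult2 m_dom(1)[OF x]] by (rule has_derivative_linear)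
  qed
  moreover have "((\<lambda>x. Dm (x, e0) (0, Ad (\<psi> x) u)) has_derivative (\<lambda>h. B2 u h)) (at e0)"
    by (rule has_derivative_transform_within_open[OF Dm_has_derivative_right open_U e0_in_U eq[symmetric]])
  ultimately have "(\<lambda>h. B2 h (Ad (\<psi> e0) u) + Dm (e0, e0) (0, a' h)) = (\<lambda>h. B2 u h)"
    by (rule has_derivative_unique)
  from fun_cong[OF this] have "B2 h u + a' h = B2 u h" for h
    by (simp add: Dm_left_one e0_in_U)
  then have "a' = (\<lambda>h. B2 u h - B2 h u)" by (auto simp: algebra_simps)
  with a' show ?thesis by simp
qed

lemma Ad_curve_derivative:
  assumes "continuous (at (0::real)) \<gamma>" "\<gamma> 0 = \<one>"
    and "((\<lambda>t. \<phi> (\<gamma> t)) has_vector_derivative v) (at 0)"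
  shows "((\<lambda>t. Ad (\<gamma> t) u) has_vector_derivative (B2 u v - B2 v u)) (at 0)"
proof -
  have lin: "linear (\<lambda>h. B2 u h - B2 h u)"
    by (rule has_derivative_linear[OF Ad_coord_derivative])
  have "((\<lambda>t. Ad (\<gamma> t) u) has_derivative (\<lambda>t. B2 u (t *\<^sub>R v) - B2 (t *\<^sub>R v) u)) (at 0)"
    by (rule chain_through_chart[OF chart assms(1) _ assms(3)[unfolded has_vector_derivative_def]])
      (simp_all add: assms(2) one_in_chart Ad_coord_derivative)
  then show ?thesis
    using linear_scale[OF lin] by (simp add: has_vector_derivative_def)
qed

text \<open>Smoothness makes the curve differentiable in the chart, so the total operator
  \<open>vector_derivative\<close> in \<open>velocity\<close> is a true derivative.\<close>

lemma curve_velocity: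
  assumes \<gamma>: "smooth_map_on vs_atlas A S \<gamma>" and S: "open S" "(0::real) \<in> S"
    and "\<gamma> 0 = \<one>" "velocity A \<gamma> 0 = \<eta>"
  shows "continuous (at 0) \<gamma>" "((\<lambda>t. \<phi> (\<gamma> t)) has_vector_derivative \<eta> d) (at 0)"
proof -
  show "continuous (at 0) \<gamma>"
    using smooth_map_on_continuous[OF \<gamma>] S by (simp add: continuous_on_eq_continuous_at)
  have dA: "d \<in> A" using d by (simp add: charts_at_def)
  have "smooth_on (S \<inter> \<gamma> -` fst d) (\<lambda>t. \<phi> (\<gamma> t))"
    using smooth_map_onD[OF \<gamma> _ dA, of "(UNIV, \<lambda>x. x)"] by (simp add: vs_atlas_def)
  then have "(\<lambda>t. \<phi> (\<gamma> t)) differentiable (at 0)"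
    by (rule smooth_on_differentiable) (use assms one_in_chart in simp)
  moreover have "\<eta> d = vector_derivative (\<lambda>t. \<phi> (\<gamma> t)) (at 0)"
    using assms(4,5) d by (auto simp: velocity_def o_def)
  ultimately show "((\<lambda>t. \<phi> (\<gamma> t)) has_vector_derivative \<eta> d) (at 0)"
    by (simp add: vector_derivative_works)
qed

end

section \<open>Central exponentials\<close>

text \<open>For the first equation, a left and a right Leibniz identity share two terms, which
  cancel; for the second, the left identities at \<open>(u, v, w)\<close> and
  \<open>(v, u, w)\<close> do. The first makes the symmetric part vanish on products, the second
  makes its values multiply by zero from the left.\<close>

lemma symmetric_leibniz_products:
  assumes "symmetric_leibniz p"
  shows "p (p u w) v + p v (p u w) = 0" "p (p u v + p v u) w = 0"
proof -
  have bil: "bilinear p"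
    and l: "\<And>u v w. p u (p v w) = p (p u v) w + p v (p u w)"
    and r: "\<And>u v w. p (p v w) u = p (p v u) w + p v (p w u)"
    using assms unfolding symmetric_leibniz_def left_leibniz_def right_leibniz_def by blast+
  have cancel: "d + c = 0" if "a = b + c" "b = d + a" for a b c d :: 'a
  proof -
    have "b + (d + c) = b" using that by (simp add: add.commute add.left_commute)
    then show ?thesis by simp
  qed
  show "p (p u w) v + p v (p u w) = 0"
    by (rule cancel[OF l[of u v w] r[of u v w]])
  have "p (p v u) w + p (p u v) w = 0"
    by (rule cancel[OF trans[OF l[of u v w] add.commute] l[of v u w]])
  then show "p (p u v + p v u) w = 0"
    by (simp add: bilinear_ladd[OF bil] add.commute)
qed

locale leibniz_lie_group = lie_group_chart A G d
  for A :: "('g::{t2_space, second_countable_topology}, 'e::real_normed_vector) chart set"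
    and G (structure) and d +
  fixes p :: "'l::real_vector \<Rightarrow> 'l \<Rightarrow> 'l"
    and \<iota> :: "'l \<Rightarrow> ('g, 'e) tvec"
    and ex :: "'l \<Rightarrow> 'g"
    and q :: "'l \<Rightarrow> 'q::real_normed_vector"
    and \<kappa> :: "'g \<Rightarrow> 'q"
  assumes fin_dim_l: "finite_dim TYPE('l)"
    and leibniz: "symmetric_leibniz p"
    and conn: "connected (UNIV :: 'g set)"
    and ident: "lie_algebra_ident A G (skew_part p) \<iota>"
    and exp_map: "exponential_map A G \<iota> ex"
    and quot: "leibniz_quotient p q"
    and integ: "integrates_hom A G \<iota> q \<kappa>"
begin

lemma bilinear_p: "bilinear p"
  using leibniz by (simp add: symmetric_leibniz_def left_leibniz_def)

lemma linear_\<iota>: "linear (\<lambda>u. \<iota> u c)"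
  using ident unfolding lie_algebra_ident_def by blast

lemma \<iota>_tangent: "\<iota> u \<in> tangent_space A \<one>"
  using ident by (auto simp: lie_algebra_ident_def bij_betw_def)

lemma \<iota>_surj:
  obtains u where "\<iota> u d = v"
proof -
  obtain \<zeta> where \<zeta>: "\<zeta> \<in> tangent_space A \<one>" "\<zeta> d = v"
    by (rule tangent_vector_exists[OF atlas d])
  have "range \<iota> = tangent_space A \<one>"
    using ident unfolding lie_algebra_ident_def bij_betw_def by blast
  with \<zeta>(1) have "\<zeta> \<in> range \<iota>" by simp
  then obtain u where "\<zeta> = \<iota> u" by blast
  with \<zeta>(2) that show ?thesis by blast
qed

lemma \<iota>_skew: "\<iota> (skew_part p u v) d = B2 (\<iota> u d) (\<iota> v d) - B2 (\<iota> v d) (\<iota> u d)"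
  using ident lie_bracket_coord[OF \<iota>_tangent \<iota>_tangent] by (simp add: lie_algebra_ident_def)

lemma exp_smooth: "smooth_map vs_atlas A (\<lambda>t. ex (t *\<^sub>R v))"
  and exp_add: "ex ((s + t) *\<^sub>R v) = ex (s *\<^sub>R v) \<otimes> ex (t *\<^sub>R v)"
  and exp_velocity: "velocity A (\<lambda>t. ex (t *\<^sub>R v)) 0 = \<iota> v"
  using exp_map by (simp_all add: exponential_map_def Let_def)

lemma exp_zero [simp]: "ex 0 = \<one>"
  using exp_add[of 0 0 0] inv_cancel(1)[of "ex 0" "ex 0"] by simp

lemma exp_minus: "ex v \<otimes> ex (- v) = \<one>"
  using exp_add[of 1 "-1" v] by simp

lemma exp_curve:
  "continuous (at 0) (\<lambda>t. ex (t *\<^sub>R v))"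
  "((\<lambda>t. \<phi> (ex (t *\<^sub>R v))) has_vector_derivative \<iota> v d) (at 0)"
  by (rule curve_velocity[OF exp_smooth open_UNIV UNIV_I _ exp_velocity], simp)+

lemma \<kappa>_smooth: "smooth_map A vs_atlas \<kappa>"
  and \<kappa>_mult [simp]: "\<kappa> (g \<otimes> h) = \<kappa> g + \<kappa> h"
  and \<kappa>_tangent: "tangent_map A vs_atlas \<kappa> \<one> (\<iota> u) (UNIV, \<lambda>x. x) = q u"
  using integ by (simp_all add: integrates_hom_def)

lemma \<kappa>_one [simp]: "\<kappa> \<one> = 0"
  using \<kappa>_mult[of \<one> \<one>] by simp

lemma \<kappa>_inv [simp]: "\<kappa> (inv g) = - \<kappa> g"
  using \<kappa>_mult[of g "inv g"] by (simp add: eq_neg_iff_add_eq_0 add.commute del: \<kappa>_mult)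

lemma \<kappa>_curve:
  assumes "continuous (at (0::real)) \<gamma>" "\<gamma> 0 = \<one>"
    and "((\<lambda>t. \<phi> (\<gamma> t)) has_vector_derivative \<iota> v d) (at 0)"
  shows "((\<lambda>t. \<kappa> (\<gamma> t)) has_vector_derivative q v) (at 0)"
proof -
  let ?D = "frechet_derivative (\<lambda>y. \<kappa> (\<psi> y)) (at e0)"
  have id: "(UNIV, \<lambda>x. x) \<in> charts_at vs_atlas (\<kappa> \<one>)"
    by (simp add: charts_at_def vs_atlas_def)
  have D: "((\<lambda>y. \<kappa> (\<psi> y)) has_derivative ?D) (at e0)"
    using smooth_map_differentiable_chart[OF \<kappa>_smooth d id] by simp
  have qv: "?D (\<iota> v d) = q v"
    using tangent_map_chart[OF atlas \<kappa>_smooth \<iota>_tangent d id] \<kappa>_tangent by simp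
  have "((\<lambda>t. \<kappa> (\<gamma> t)) has_derivative (\<lambda>h. ?D (h *\<^sub>R \<iota> v d))) (at 0)"
    by (rule chain_through_chart[OF chart assms(1) _ assms(3)[unfolded has_vector_derivative_def]])
      (simp_all add: assms(2) one_in_chart D)
  then show ?thesis
    using linear_scale[OF has_derivative_linear[OF D]] qv by (simp add: has_vector_derivative_def)
qed

text \<open>The defect \<open>k\<close> is additive in \<open>t\<close> with derivative zero at 0.
  Additivity carries this to every \<open>t\<close>, so \<open>k 1 = k 0\<close>.\<close>

lemma \<kappa>_exp: "\<kappa> (ex v) = q v"
proof -
  define k where "k t = \<kappa> (ex (t *\<^sub>R v)) - t *\<^sub>R q v" for t
  have k0: "(k has_derivative (\<lambda>h. 0)) (at 0)"
    using has_derivative_diff[OF \<kappa>_curve[OF exp_curve(1) _ exp_curve(2), unfolded has_vector_derivative_def]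
        has_derivative_scaleR_left[OF has_derivative_ident], of v "q v"]
    unfolding k_def by simp
  have "(k has_derivative (\<lambda>h. 0)) (at t)" for t
  proof -
    have k_add: "k s = k (s - t) + k t" for s
      using exp_add[of "s - t" t v] by (simp add: k_def scaleR_diff_left)
    then have eq: "(\<lambda>s. k (s - t) + k t) = k" by (intro ext) (rule sym)
    have "((\<lambda>s. s - t) has_derivative (\<lambda>h. h)) (at t)"
      by (auto intro!: derivative_eq_intros)
    from has_derivative_compose[OF this, of k "\<lambda>h. 0"] k0
    have "((\<lambda>s. k (s - t)) has_derivative (\<lambda>h. 0)) (at t)" by simp
    then have "((\<lambda>s. k (s - t) + k t) has_derivative (\<lambda>h. 0)) (at t)"
      by (rule has_derivative_add_const)
    then show ?thesis unfolding eq .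
  qed
  from has_derivative_zero_unique[OF convex_UNIV has_derivative_at_withinI[OF this], of 1 0]
  show ?thesis by (simp add: k_def)
qed

section \<open>The center and its exponentials\<close>

definition Z :: "'l set" where
  "Z = {z. \<forall>u. skew_part p z u = 0}"

lemma skew_zero_right: "z \<in> Z \<Longrightarrow> skew_part p u z = 0"
  unfolding Z_def skew_part_def by auto

lemma Z_subspace: "subspace Z"
  unfolding Z_def skew_part_def subspace_def
  by (auto simp: bilinear_ladd[OF bilinear_p] bilinear_radd[OF bilinear_p] bilinear_lmul[OF bilinear_p]
      bilinear_rmul[OF bilinear_p] bilinear_lzero[OF bilinear_p] bilinear_rzero[OF bilinear_p])

text \<open>The derivative of \<open>a\<close> at 0 is the bracket of \<open>u\<close> with
  \<open>z\<close>, which is zero. The group law writes \<open>a s\<close> as a fixed linear map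
  applied to \<open>a (s - t)\<close>, so the derivative vanishes at every \<open>t\<close>.\<close>

lemma Ad_exp_center:
  assumes "z \<in> Z"
  shows "Ad (ex z) v = v"
proof -
  obtain u where u: "\<iota> u d = v" by (rule \<iota>_surj)
  have zero: "B2 (\<iota> u d) (\<iota> z d) - B2 (\<iota> z d) (\<iota> u d) = 0"
    using \<iota>_skew[of u z] skew_zero_right[OF assms] linear_0[OF linear_\<iota>] by simp
  define a where "a t = Ad (ex (t *\<^sub>R z)) v" for t
  have a0: "(a has_derivative (\<lambda>h. 0)) (at 0)"
    using Ad_curve_derivative[OF exp_curve(1) _ exp_curve(2), of z v] zero u
    by (simp add: a_def[abs_def] has_vector_derivative_def)
  have "(a has_derivative (\<lambda>h. 0)) (at t)" for t
  proof -
    have a_add: "a s = Ad (ex (t *\<^sub>R z)) (a (s - t))" for s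
      using exp_add[of "s - t" t z] by (simp add: a_def Ad_mult)
    then have eq: "(\<lambda>s. Ad (ex (t *\<^sub>R z)) (a (s - t))) = a" by (intro ext) (rule sym)
    have "((\<lambda>s. s - t) has_derivative (\<lambda>h. h)) (at t)"
      by (auto intro!: derivative_eq_intros)
    from has_derivative_compose[OF this, of a "\<lambda>h. 0"] a0
    have "((\<lambda>s. a (s - t)) has_derivative (\<lambda>h. 0)) (at t)" by simp
    from bounded_linear.has_derivative[OF has_derivative_bounded_linear[OF Ad_has_derivative] this]
    have "((\<lambda>s. Ad (ex (t *\<^sub>R z)) (a (s - t))) has_derivative (\<lambda>h. Ad (ex (t *\<^sub>R z)) 0)) (at t)" .
    moreover have "Ad (ex (t *\<^sub>R z)) 0 = 0"
      by (rule linear_0[OF has_derivative_linear[OF Ad_has_derivative]])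
    ultimately show ?thesis unfolding eq by simp
  qed
  from has_derivative_zero_unique[OF convex_UNIV has_derivative_at_withinI[OF this], of 1 0]
  show ?thesis by (simp add: a_def)
qed

text \<open>The map \<open>y \<mapsto> (g\<inverse> y g) y\<inverse>\<close> with \<open>g = ex z\<close> has derivative zero at the identity, and by
  translation everywhere, so it is constant.\<close>

lemma conjugate_exp_center:
  assumes "z \<in> Z"
  shows "conjugate (ex z) y = y"
proof -
  define g where "g = ex z"
  define F where "F y = conjugate g y \<otimes> inv y" for y
  note inv_smooth = smooth_inv[OF atlas smooth_map_id[OF atlas]]
  have F_smooth: "smooth_map A A F"
    unfolding F_def by (intro smooth_mult[OF atlas] smooth_conjugate inv_smooth)
  have F_one: "F \<one> = \<one>" by (simp add: F_def)
  obtain I where I: "((\<lambda>y. \<phi> (inv (\<psi> y))) has_derivative I) (at e0)"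
    using smooth_map_differentiable_chart[OF inv_smooth d, of d] d by auto
  note cont = continuous_at_compose_\<psi>[OF inv_smooth]
  have id: "((\<lambda>y. \<phi> (\<psi> y)) has_derivative (\<lambda>v. v)) (at e0)"
    by (rule has_derivative_transform_within_open[OF has_derivative_ident open_U e0_in_U])
      (auto simp: \<psi>\<phi>)
  \<comment> \<open>Differentiating \<open>y \<otimes> inv y = \<one>\<close> shows that inversion
    has derivative minus the identity, in the form in which it enters \<open>F\<close>.\<close>
  have "((\<lambda>y. \<phi> (\<psi> y \<otimes> inv (\<psi> y))) has_derivative (\<lambda>v. v + I v)) (at e0)"
    by (rule mult_has_derivative[OF continuous_at_\<psi> cont _ _ id I]) simp_all
  moreover have "((\<lambda>y. \<phi> (\<psi> y \<otimes> inv (\<psi> y))) has_derivative (\<lambda>v. 0)) (at e0)"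
    by simp
  ultimately have I_eq: "(\<lambda>v. v + I v) = (\<lambda>v. 0)" by (rule has_derivative_unique)
  have "Ad g = (\<lambda>v. v)" using Ad_exp_center[OF assms] by (auto simp: g_def)
  then have "((\<lambda>y. \<phi> (conjugate g (\<psi> y))) has_derivative (\<lambda>v. v)) (at e0)"
    using Ad_has_derivative[of g] by simp
  from mult_has_derivative[OF continuous_at_compose_\<psi>[OF smooth_conjugate] cont _ _ this I]
  have zero: "((\<lambda>y. \<phi> (F (\<psi> y))) has_derivative (\<lambda>_. 0)) (at e0)"
    by (simp add: F_def I_eq)
  have "F y = F \<one>"
  proof (rule zero_derivative_imp_constant[OF atlas atlas conn smooth_map_on_continuous[OF F_smooth]])
    fix x c e assume c: "c \<in> charts_at A x" and e: "e \<in> charts_at A (F x)"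
    \<comment> \<open>Conjugation is a homomorphism, so \<open>F y\<close> is obtained by
      translations from \<open>F\<close> at \<open>inv x \<otimes> y\<close>, which is the identity
      at \<open>y = x\<close>.\<close>
    have F_eq: "F y = conjugate g x \<otimes> F (inv x \<otimes> y) \<otimes> inv x" for y
      by (simp add: F_def conjugate_def m_assoc)
    have "((\<lambda>y. snd e (conjugate g x \<otimes> F (inv x \<otimes> chart_inv c y) \<otimes> inv x)) has_derivative (\<lambda>_. 0))
        (at (snd c x))"
    proof (rule zero_derivative_compose[OF atlas atlas atlas smooth_translation F_smooth _ c])
      show "smooth_map A A (\<lambda>y. conjugate g x \<otimes> y \<otimes> inv x)"
        by (intro smooth_mult[OF atlas] smooth_map_const smooth_map_id[OF atlas])
      show "d \<in> charts_at A (inv x \<otimes> x)" "d \<in> charts_at A (F (inv x \<otimes> x))"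
        using d by (simp_all add: F_one)
      show "e \<in> charts_at A (conjugate g x \<otimes> F (inv x \<otimes> x) \<otimes> inv x)"
        using e F_eq[of x] by simp
    qed (simp add: zero)
    then show "((\<lambda>y. snd e (F (chart_inv c y))) has_derivative (\<lambda>_. 0)) (at (snd c x))"
      by (simp add: F_eq[symmetric])
  qed
  then have "F y \<otimes> y = y" by (simp add: F_one)
  then show ?thesis by (simp add: F_def g_def m_assoc)
qed

lemma exp_center_commute:
  assumes "z \<in> Z"
  shows "ex z \<otimes> y = y \<otimes> ex z"
proof -
  have "ex z \<otimes> conjugate (ex z) y = y \<otimes> ex z" by (simp add: conjugate_def m_assoc)
  then show ?thesis by (simp add: conjugate_exp_center[OF assms])
qed

lemma exp_center_left_commute: "z \<in> Z \<Longrightarrow> y \<otimes> (ex z \<otimes> x) = ex z \<otimes> (y \<otimes> x)"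
  using exp_center_commute[of z y] by (simp add: m_assoc[symmetric])

lemma atlas_real: "atlas (vs_atlas :: (real, real) chart set)"
  by (rule atlas_vs_atlas[OF finite_dim_real])

text \<open>\<open>\<delta>\<close> measures the failure of additivity. Central exponentials
  commute, so \<open>\<delta>\<close> is a one-parameter subgroup; its velocity at 0 is that of
  \<open>u + v - (u + v)\<close>, and translation makes it constant.\<close>

lemma exp_add_center:
  assumes "u \<in> Z" "v \<in> Z"
  shows "ex (u + v) = ex u \<otimes> ex v"
proof -
  let ?w = "- (u + v)"
  have Z: "t *\<^sub>R u \<in> Z" "t *\<^sub>R v \<in> Z" "t *\<^sub>R ?w \<in> Z" for t
    using assms Z_subspace by (meson subspace_add subspace_neg subspace_scale)+
  define \<delta> where "\<delta> t = ex (t *\<^sub>R u) \<otimes> ex (t *\<^sub>R v) \<otimes> ex (t *\<^sub>R ?w)" for t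
  have \<delta>_smooth: "smooth_map vs_atlas A \<delta>"
    unfolding \<delta>_def by (intro smooth_mult[OF atlas_real] exp_smooth)
  have \<delta>_zero: "\<delta> 0 = \<one>" by (simp add: \<delta>_def)
  have \<delta>_add: "\<delta> (s + t) = \<delta> s \<otimes> \<delta> t" for s t
    using exp_center_left_commute[OF Z(2), of "ex (t *\<^sub>R u)" s]
      exp_center_left_commute[OF Z(3), of "ex (t *\<^sub>R v)" s]
      exp_center_left_commute[OF Z(3), of "ex (t *\<^sub>R u)" s]
    by (simp only: \<delta>_def exp_add) (simp add: m_assoc)
  have "((\<lambda>t. \<phi> (\<delta> t)) has_derivative (\<lambda>h. h *\<^sub>R \<iota> u d + h *\<^sub>R \<iota> v d + h *\<^sub>R \<iota> ?w d)) (at 0)"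
    unfolding \<delta>_def
    by (intro mult_has_derivative exp_curve[unfolded has_vector_derivative_def]
        smooth_map_continuous_at[of vs_atlas A] smooth_mult[OF atlas_real] exp_smooth) simp_all
  moreover have "h *\<^sub>R \<iota> u d + h *\<^sub>R \<iota> v d + h *\<^sub>R \<iota> ?w d = 0" for h
    unfolding linear_neg[OF linear_\<iota>] linear_add[OF linear_\<iota>] by (simp add: algebra_simps)
  ultimately have zero: "((\<lambda>t. \<phi> (\<delta> t)) has_derivative (\<lambda>_. 0)) (at 0)" by simp
  have "\<delta> 1 = \<delta> 0"
  proof (rule zero_derivative_imp_constant[OF atlas_real atlas _ smooth_map_on_continuous[OF \<delta>_smooth]])
    fix t :: real and c e assume c: "c \<in> charts_at vs_atlas t" and e: "e \<in> charts_at A (\<delta> t)"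
    have \<delta>_eq: "\<delta> t \<otimes> \<delta> (s - t) = \<delta> s" for s
      using \<delta>_add[of t "s - t"] by simp
    have "((\<lambda>s. snd e (\<delta> t \<otimes> \<delta> (chart_inv c s - t))) has_derivative (\<lambda>_. 0)) (at (snd c t))"
    proof (rule zero_derivative_compose[OF atlas_real atlas atlas_real _ \<delta>_smooth smooth_translation c])
      have "smooth_on UNIV (\<lambda>s. s + - t)"
        by (intro smooth_on_add smooth_on_const smooth_on_bounded_linear bounded_linear_ident open_UNIV)
      then show "smooth_map vs_atlas vs_atlas (\<lambda>s. s - t)"
        by (intro smooth_map_vs_atlas) simp
      show "(UNIV, \<lambda>x. x) \<in> charts_at vs_atlas (t - t)" "d \<in> charts_at A (\<delta> (t - t))"
        "e \<in> charts_at A (\<delta> t \<otimes> \<delta> (t - t))"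
        using e d by (simp_all add: charts_at_def vs_atlas_def \<delta>_zero)
    qed (simp add: zero)
    then show "((\<lambda>s. snd e (\<delta> (chart_inv c s))) has_derivative (\<lambda>_. 0)) (at (snd c t))"
      by (simp add: \<delta>_eq)
  qed (rule connected_UNIV)
  then have "ex u \<otimes> ex v \<otimes> ex ?w = \<one>" by (simp add: \<delta>_def)
  then have "ex u \<otimes> ex v \<otimes> ex ?w = ex (u + v) \<otimes> ex ?w" by (simp only: exp_minus)
  then show ?thesis by simp
qed

section \<open>The rack of a symmetric Leibniz algebra\<close>

lemma linear_q: "linear q"
  and surj_q: "surj q"
  and kernel_q: "{u. q u = 0} = span {p u v | u v. True}"
  using quot unfolding leibniz_quotient_def by blast+

lemma sym_part_commute: "sym_part p u v = sym_part p v u"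
  by (simp add: sym_part_def add.commute)

lemma linear_sym_part: "linear (\<lambda>u. sym_part p u v)"
  by (intro linearI)
    (simp_all add: sym_part_def bilinear_ladd[OF bilinear_p] bilinear_radd[OF bilinear_p]
      bilinear_lmul[OF bilinear_p] bilinear_rmul[OF bilinear_p] scaleR_add_right)

text \<open>Products span the kernel of \<open>q\<close>, and the symmetric part vanishes on them.
  This makes \<open>\<beta>\<close> independent of the chosen preimages.\<close>

lemma sym_part_kernel:
  assumes "q u = 0"
  shows "sym_part p u v = 0"
proof -
  have "u \<in> span {p u v | u v. True}" using assms kernel_q by blast
  then show ?thesis
  proof (rule span_induct)
    show "subspace {u. sym_part p u v = 0}"
      by (rule linear_subspace_kernel[OF linear_sym_part])
  qed (auto simp: sym_part_def symmetric_leibniz_products(1)[OF leibniz])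
qed

abbreviation "\<beta> \<equiv> leibniz_beta p q"

lemma beta_q: "\<beta> (q u) (q v) = sym_part p u v"
proof -
  have eq: "sym_part p (inv_into UNIV q (q u)) w = sym_part p u w" for u w
  proof -
    have "q (inv_into UNIV q (q u) - u) = 0"
      using surj_q by (simp add: linear_diff[OF linear_q] surj_f_inv_f)
    from sym_part_kernel[OF this, of w] show ?thesis
      by (simp add: linear_diff[OF linear_sym_part])
  qed
  have "\<beta> (q u) (q v) = sym_part p u (inv_into UNIV q (q v))"
    by (simp add: leibniz_beta_def eq)
  also have "\<dots> = sym_part p u v"
    using eq[of v u] by (simp add: sym_part_commute)
  finally show ?thesis .
qed

lemma q_cases:
  obtains u where "x = q u"
  using surj_q by (metis surjD)

lemma beta_commute: "\<beta> x y = \<beta> y x"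
  by (simp add: leibniz_beta_def sym_part_commute)

lemma linear_beta: "linear (\<lambda>x. \<beta> x y)"
proof (rule linearI)
  fix a b c
  obtain u v w where uvw: "a = q u" "b = q v" "y = q w" by (metis q_cases)
  show "\<beta> (a + b) y = \<beta> a y + \<beta> b y"
    unfolding uvw linear_add[OF linear_q, symmetric] beta_q by (rule linear_add[OF linear_sym_part])
  show "\<beta> (c *\<^sub>R a) y = c *\<^sub>R \<beta> a y"
    unfolding uvw linear_scale[OF linear_q, symmetric] beta_q by (rule linear_scale[OF linear_sym_part])
qed

lemma linear_beta_right: "linear (\<lambda>y. \<beta> x y)"
  using linear_beta[of x] by (simp add: beta_commute)

text \<open>Values of the symmetric part are combinations of products, which \<open>q\<close> kills;
  so factors \<open>chi\<close> are invisible to \<open>\<kappa>\<close>.\<close>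

lemma q_beta: "q (\<beta> x y) = 0"
proof -
  obtain u v where uv: "x = q u" "y = q v" by (metis q_cases)
  have "sym_part p u v \<in> span {p u v | u v. True}"
    unfolding sym_part_def by (intro span_scale span_add span_base) auto
  then show ?thesis unfolding uv beta_q using kernel_q by blast
qed

text \<open>A value of the symmetric part annihilates from the left, and products anticommute with
  every element, so it annihilates from the right too.\<close>

lemma beta_center: "\<beta> x y \<in> Z"
proof -
  obtain u v where uv: "x = q u" "y = q v" by (metis q_cases)
  have left: "p (p u v + p v u) w = 0" for w
    by (rule symmetric_leibniz_products(2)[OF leibniz])
  have "p w (p u v + p v u) = - p (p u v + p v u) w" for w
    using symmetric_leibniz_products(1)[OF leibniz, of u v w]
      symmetric_leibniz_products(1)[OF leibniz, of v u w]
    by (simp add: bilinear_ladd[OF bilinear_p] bilinear_radd[OF bilinear_p] eq_neg_iff_add_eq_0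
        algebra_simps)
  then have "skew_part p (sym_part p u v) w = 0" for w
    by (simp add: skew_part_def sym_part_def bilinear_lmul[OF bilinear_p] bilinear_rmul[OF bilinear_p] left)
  then show ?thesis unfolding uv beta_q Z_def by blast
qed

section \<open>The rack operation as a right action of the group\<close>

abbreviation "chi \<equiv> leibniz_chi p q \<kappa> ex"
abbreviation "r \<equiv> leibniz_rack_op G p q \<kappa> ex"

lemma chi_commute: "chi h g \<otimes> y = y \<otimes> chi h g"
  unfolding leibniz_chi_def by (rule exp_center_commute[OF beta_center])

lemma chi_left_commute: "y \<otimes> (chi h g \<otimes> x) = chi h g \<otimes> (y \<otimes> x)"
  unfolding leibniz_chi_def by (rule exp_center_left_commute[OF beta_center])

lemma \<kappa>_chi: "\<kappa> (chi h g) = 0"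
  by (simp add: leibniz_chi_def \<kappa>_exp q_beta)

lemma chi_mult: "chi h (g \<otimes> g') = chi h g \<otimes> chi h g'"
  unfolding leibniz_chi_def \<kappa>_mult linear_add[OF linear_beta_right]
  by (rule exp_add_center[OF beta_center beta_center])

lemma chi_zero: "\<kappa> h = 0 \<or> \<kappa> g = 0 \<Longrightarrow> chi h g = \<one>"
  by (auto simp: leibniz_chi_def linear_0[OF linear_beta] linear_0[OF linear_beta_right])

lemma r_conjugate: "r h g = conjugate g h \<otimes> chi h g"
  by (simp add: leibniz_rack_op_def conjugate_def)

lemma \<kappa>_r: "\<kappa> (r h g) = \<kappa> h"
  by (simp add: leibniz_rack_op_def \<kappa>_chi)

text \<open>The target of \<open>\<kappa>\<close> is abelian and \<open>chi\<close> lies in the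
  kernel, so \<open>\<kappa> (r h g) = \<kappa> h\<close> and
  \<open>chi (r h g) g' = chi h g'\<close>. The central factors are then collected by
  \<open>chi_mult\<close>.\<close>

lemma r_mult: "r (r h g) g' = r h (g \<otimes> g')"
proof -
  have chi_r: "chi (r h g) g' = chi h g'" by (simp add: leibniz_chi_def \<kappa>_r)
  have "r (r h g) g' = inv g' \<otimes> (inv g \<otimes> (h \<otimes> (g \<otimes> (chi h g \<otimes> (g' \<otimes> chi h g')))))"
    unfolding leibniz_rack_op_def[of G p q \<kappa> ex "r h g"] chi_r
    by (simp add: leibniz_rack_op_def m_assoc)
  also have "chi h g \<otimes> (g' \<otimes> chi h g') = g' \<otimes> (chi h g \<otimes> chi h g')"
    by (rule chi_left_commute[symmetric])
  also have "inv g' \<otimes> (inv g \<otimes> (h \<otimes> (g \<otimes> (g' \<otimes> (chi h g \<otimes> chi h g'))))) = r h (g \<otimes> g')"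
    by (simp add: leibniz_rack_op_def chi_mult m_assoc)
  finally show ?thesis .
qed

lemma r_one [simp]: "r h \<one> = h" "r \<one> g = \<one>"
  by (simp_all add: r_conjugate chi_zero conjugate_def)

text \<open>Values of \<open>chi\<close> are central and killed by \<open>\<kappa>\<close>, so
  neither conjugation nor the extra factor moves \<open>h\<close>.\<close>

lemma r_chi: "r h (chi x y) = h"
proof -
  have "chi h (chi x y) = \<one>" by (rule chi_zero) (simp add: \<kappa>_chi)
  then show ?thesis
    by (simp add: r_conjugate conjugate_def m_assoc chi_commute[of x y h, symmetric])
qed

lemma r_inv: "r (r y x) (inv x) = y" "r (r y (inv x)) x = y"
  by (simp_all add: r_mult)

text \<open>By \<open>r_mult\<close> both sides of self-distributivity are actions on
  \<open>x\<close>, by \<open>z \<otimes> r y z = y \<otimes> z \<otimes> chi y z\<close> and by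
  \<open>y \<otimes> z\<close>; the factor \<open>chi y z\<close> acts trivially.\<close>

lemma rack_r: "rack r"
  unfolding rack_def
proof (intro conjI allI)
  show "bij (\<lambda>y. r y x)" for x
    by (rule bij_betw_byWitness[where f' = "\<lambda>y. r y (inv x)"]) (auto simp: r_inv)
  fix x y z
  have "r (r x z) (r y z) = r x (z \<otimes> (inv z \<otimes> y \<otimes> z \<otimes> chi y z))"
    by (simp add: r_mult leibniz_rack_op_def[of G p q \<kappa> ex y z])
  also have "z \<otimes> (inv z \<otimes> y \<otimes> z \<otimes> chi y z) = (y \<otimes> z) \<otimes> chi y z"
    by (simp add: m_assoc)
  also have "r x \<dots> = r (r x y) z"
    by (simp add: r_mult[symmetric] r_chi)
  finally show "r (r x y) z = r (r x z) (r y z)" by simp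
qed

section \<open>Smoothness of the rack operation and its differential\<close>

lemma fin_dim_q: "finite_dim TYPE('q)"
  by (rule finite_dim_image[OF fin_dim_l linear_q surj_q])

lemma atlas_q: "atlas (vs_atlas :: ('q, 'q) chart set)"
  by (rule atlas_vs_atlas[OF fin_dim_q])

text \<open>Additivity on the center splits the exponential into one-parameter subgroups evaluated
  at the smooth times \<open>t x i\<close>.\<close>

lemma exp_sum_center_smooth:
  assumes M: "atlas M" and "finite I" and "\<And>i. i \<in> I \<Longrightarrow> w i \<in> Z"
    and "\<And>i. i \<in> I \<Longrightarrow> smooth_map M vs_atlas (\<lambda>x. t x i)"
  shows "smooth_map M A (\<lambda>x. ex (\<Sum>i\<in>I. t x i *\<^sub>R w i))"
  using assms(2-)
proof (induction I)
  case empty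
  then show ?case by (simp add: smooth_map_const)
next
  case (insert i I)
  have Z: "t x i *\<^sub>R w i \<in> Z" "(\<Sum>i\<in>I. t x i *\<^sub>R w i) \<in> Z" for x
    using insert.prems(1) by (auto intro!: subspace_sum subspace_scale Z_subspace)
  have "smooth_map M A (\<lambda>x. ex (t x i *\<^sub>R w i) \<otimes> ex (\<Sum>i\<in>I. t x i *\<^sub>R w i))"
  proof (rule smooth_mult[OF M])
    show "smooth_map M A (\<lambda>x. ex (t x i *\<^sub>R w i))"
      by (rule smooth_map_on_compose[OF M atlas_real atlas open_UNIV _ exp_smooth])
        (rule insert.prems(2), simp)
    show "smooth_map M A (\<lambda>x. ex (\<Sum>i\<in>I. t x i *\<^sub>R w i))"
      by (rule insert.IH) (use insert.prems in auto)
  qed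
  then show ?case
    using insert.hyps by (simp add: exp_add_center[OF Z])
qed

text \<open>In a basis of the quotient, \<open>\<beta> (\<kappa> h) (\<kappa> g)\<close> is a
  combination of fixed central vectors, with products of coordinates of \<open>\<kappa> h\<close>
  and \<open>\<kappa> g\<close> as smooth coefficients.\<close>

lemma chi_smooth: "smooth_map (prod_atlas A A) A (\<lambda>(h, g). chi h g)"
proof -
  obtain B :: "'q set" and c where B: "finite B" "\<And>b. bounded_linear (c b :: 'q \<Rightarrow> real)"
    "\<And>x. x = (\<Sum>b\<in>B. c b x *\<^sub>R b)"
    using finite_dim_coordinates[OF fin_dim_q] by blast
  have beta_sum: "\<beta> x y = (\<Sum>i\<in>B \<times> B. (c (fst i) x * c (snd i) y) *\<^sub>R \<beta> (fst i) (snd i))" for x y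
  proof -
    have "\<beta> x y = (\<Sum>a\<in>B. c a x *\<^sub>R \<beta> a y)"
      by (subst B(3)[of x]) (simp add: linear_sum[OF linear_beta] linear_scale[OF linear_beta])
    also have "\<dots> = (\<Sum>a\<in>B. \<Sum>b\<in>B. (c a x * c b y) *\<^sub>R \<beta> a b)"
    proof (rule sum.cong[OF refl])
      fix a
      have "\<beta> a y = (\<Sum>b\<in>B. c b y *\<^sub>R \<beta> a b)"
        by (subst B(3)[of y]) (simp add: linear_sum[OF linear_beta_right] linear_scale[OF linear_beta_right])
      then show "c a x *\<^sub>R \<beta> a y = (\<Sum>b\<in>B. (c a x * c b y) *\<^sub>R \<beta> a b)"
        by (simp add: scaleR_sum_right)
    qed
    finally show ?thesis by (simp add: sum.cartesian_product case_prod_unfold)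
  qed
  have "smooth_map (prod_atlas A A) A (\<lambda>z. ex (\<Sum>i\<in>B \<times> B.
      (c (fst i) (\<kappa> (fst z)) * c (snd i) (\<kappa> (snd z))) *\<^sub>R \<beta> (fst i) (snd i)))"
  proof (rule exp_sum_center_smooth[OF atlas2])
    fix i
    have "smooth_map (prod_atlas A A) vs_atlas (\<lambda>z. \<kappa> (fst z))"
      "smooth_map (prod_atlas A A) vs_atlas (\<lambda>z. \<kappa> (snd z))"
      by (rule smooth_map_on_compose[OF atlas2 atlas atlas_q open_UNIV _ \<kappa>_smooth],
          intro smooth_map_fst smooth_map_snd atlas)+
    then show "smooth_map (prod_atlas A A) vs_atlas
        (\<lambda>z. c (fst i) (\<kappa> (fst z)) * c (snd i) (\<kappa> (snd z)))"
      by (rule smooth_map_bounded_bilinear[OF atlas2 bounded_bilinear.comp[OF bounded_bilinear_mult B(2) B(2)]])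
  qed (use B(1) beta_center in auto)
  then show ?thesis
    by (simp add: beta_sum[symmetric] leibniz_chi_def case_prod_unfold)
qed

lemma r_smooth: "smooth_map (prod_atlas A A) A (\<lambda>(x, y). r x y)"
  using smooth_mult[OF atlas2 smooth_conjugate2 chi_smooth]
  by (simp add: r_conjugate case_prod_unfold)

lemma smooth_fix_right:
  assumes "smooth_map (prod_atlas A A) A (\<lambda>(x, y). F x y)"
  shows "smooth_map A A (\<lambda>y. F y x)"
  using smooth_map_on_compose[OF atlas atlas2 atlas open_UNIV
      smooth_map_Pair[OF atlas_chart[OF atlas] atlas atlas smooth_map_id[OF atlas] smooth_map_const] assms]
  by simp

lemma pointed_lie_rack_r: "pointed_lie_rack A r \<one>"
proof -
  have "diffeo A A (\<lambda>y. r y x)" for x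
  proof -
    have bij: "bij (\<lambda>y. r y x)" using rack_r by (simp add: rack_def)
    have "inv_into UNIV (\<lambda>y. r y x) = (\<lambda>y. r y (inv x))"
      by (rule Hilbert_Choice.inv_equality) (simp_all add: r_inv)
    then show ?thesis
      using bij smooth_fix_right[OF r_smooth] by (simp add: diffeo_def)
  qed
  then show ?thesis
    using lie rack_r r_smooth
    by (simp add: pointed_lie_rack_def lie_rack_def pointed_rack_def lie_group_def)
qed

text \<open>Both factors of \<open>r y x\<close> send \<open>y = \<one>\<close> to the identity, so
  their derivatives add: conjugation gives \<open>Ad x\<close>, and \<open>chi\<close> gives the
  central term.\<close>

lemma rack_Ad_eq: "rack_Ad A r \<one> x (\<iota> u) d = Ad x (\<iota> u d) + \<iota> (\<beta> (q u) (\<kappa> x)) d"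
proof -
  note chi_x = smooth_fix_right[OF chi_smooth, of x]
  have chi_one: "chi \<one> x = \<one>" by (rule chi_zero) simp
  define E where "E = frechet_derivative (\<lambda>y. \<phi> (chi (\<psi> y) x)) (at e0)"
  have E: "((\<lambda>y. \<phi> (chi (\<psi> y) x)) has_derivative E) (at e0)"
    unfolding E_def by (rule smooth_map_differentiable_chart[OF chi_x d]) (simp add: chi_one d)
  have "((\<lambda>y. \<phi> (conjugate x (\<psi> y) \<otimes> chi (\<psi> y) x)) has_derivative (\<lambda>v. Ad x v + E v)) (at e0)"
    by (rule mult_has_derivative[OF continuous_at_compose_\<psi>[OF smooth_conjugate]
          continuous_at_compose_\<psi>[OF chi_x] _ _ Ad_has_derivative E]) (simp_all add: chi_one)
  from fun_cong[OF frechet_derivative_at[OF this]]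
  have "rack_Ad A r \<one> x (\<iota> u) d = Ad x (\<iota> u d) + E (\<iota> u d)"
    using tangent_map_chart[OF atlas smooth_fix_right[OF r_smooth] \<iota>_tangent d, of d x u] d
    by (simp add: rack_Ad_def r_conjugate[symmetric])
  moreover have "E (\<iota> u d) = \<iota> (\<beta> (q u) (\<kappa> x)) d"
  proof -
    let ?w = "\<beta> (q u) (\<kappa> x)"
    \<comment> \<open>The value of \<open>E\<close> is read off along
      \<open>ex (t *\<^sub>R u)\<close>, because \<open>chi\<close> with \<open>x\<close> fixed
      turns this curve into the one-parameter subgroup of \<open>?w\<close>.\<close>
    have "((\<lambda>t. \<phi> (chi (ex (t *\<^sub>R u)) x)) has_derivative (\<lambda>h. E (h *\<^sub>R \<iota> u d))) (at 0)"
      by (rule chain_through_chart[OF chart exp_curve(1) _ exp_curve(2)[unfolded has_vector_derivative_def]])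
        (simp_all add: one_in_chart E)
    moreover have "chi (ex (t *\<^sub>R u)) x = ex (t *\<^sub>R ?w)" for t
      by (simp add: leibniz_chi_def \<kappa>_exp linear_scale[OF linear_q] linear_scale[OF linear_beta])
    ultimately have "((\<lambda>t. \<phi> (ex (t *\<^sub>R ?w))) has_derivative (\<lambda>h. E (h *\<^sub>R \<iota> u d))) (at 0)" by simp
    from fun_cong[OF has_derivative_unique[OF this exp_curve(2)[unfolded has_vector_derivative_def]], of 1]
    show ?thesis by simp
  qed
  ultimately show ?thesis by simp
qed

lemma rack_Ad_curve_derivative:
  assumes "smooth_map_on vs_atlas A S c" "open S" "(0::real) \<in> S" "c 0 = \<one>" "velocity A c 0 = \<iota> v"
  shows "((\<lambda>t. rack_Ad A r \<one> (c t) (\<iota> u) d) has_vector_derivative \<iota> (p u v) d) (at 0)"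
proof -
  note c = curve_velocity[OF assms]
  have "((\<lambda>t. Ad (c t) (\<iota> u d)) has_vector_derivative \<iota> (skew_part p u v) d) (at 0)"
    unfolding \<iota>_skew by (rule Ad_curve_derivative[OF c(1) assms(4) c(2)])
  moreover have "((\<lambda>t. \<iota> (\<beta> (q u) (\<kappa> (c t))) d) has_vector_derivative \<iota> (\<beta> (q u) (q v)) d) (at 0)"
  proof (rule bounded_linear.has_vector_derivative[OF _ \<kappa>_curve[OF c(1) assms(4) c(2)]])
    \<comment> \<open>Finite dimension of the quotient makes this linear map bounded, so that it
      commutes with differentiation.\<close>
    show "bounded_linear (\<lambda>y. \<iota> (\<beta> (q u) y) d)"
      using linear_compose[OF linear_beta_right linear_\<iota>]
      by (intro linear_finite_dim_imp_bounded_linear fin_dim_q) (simp add: o_def)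
  qed
  ultimately have "((\<lambda>t. rack_Ad A r \<one> (c t) (\<iota> u) d) has_vector_derivative
      \<iota> (skew_part p u v) d + \<iota> (sym_part p u v) d) (at 0)"
    unfolding rack_Ad_eq beta_q by (rule has_vector_derivative_add)
  moreover have "\<iota> (skew_part p u v) d + \<iota> (sym_part p u v) d = \<iota> (p u v) d"
  proof -
    have "skew_part p u v + sym_part p u v = p u v"
      by (simp add: skew_part_def sym_part_def scaleR_add_right[symmetric] scaleR_half_double)
    then show ?thesis using linear_add[OF linear_\<iota>] by metis
  qed
  ultimately show ?thesis by simp
qed

end

theorem theorem3p2:
  fixes p :: "'l::real_vector \<Rightarrow> 'l \<Rightarrow> 'l"
    and A :: "('g::{t2_space, second_countable_topology}, 'e::real_normed_vector) chart set"
    and G :: "'g monoid"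
    and \<iota> :: "'l \<Rightarrow> ('g, 'e) tvec"
    and ex :: "'l \<Rightarrow> 'g"
    and q :: "'l \<Rightarrow> 'q::real_normed_vector"
    and \<kappa> :: "'g \<Rightarrow> 'q"
  assumes "finite_dim TYPE('l)"
    and "symmetric_leibniz p"
    and "lie_group A G"
    and "connected (UNIV :: 'g set)"
    and "simply_connected (UNIV :: 'g set)"
    and "lie_algebra_ident A G (skew_part p) \<iota>"
    and "exponential_map A G \<iota> ex"
    and "leibniz_quotient p q"
    and "integrates_hom A G \<iota> q \<kappa>"
  shows "pointed_lie_rack A (leibniz_rack_op G p q \<kappa> ex) \<one>\<^bsub>G\<^esub> \<and>
    (\<forall>u v. rack_product A (leibniz_rack_op G p q \<kappa> ex) \<one>\<^bsub>G\<^esub> (\<iota> u) (\<iota> v) = \<iota> (p u v))"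
proof -
  \<comment> \<open>One instance for each chart around the identity, since
    \<open>rack_product\<close> tests the derivative in all of them.\<close>
  have loc: "leibniz_lie_group A G d p \<iota> ex q \<kappa>" if "d \<in> charts_at A \<one>\<^bsub>G\<^esub>" for d
    using assms that
    by (simp add: leibniz_lie_group_def lie_group_chart_def leibniz_lie_group_axioms_def)
  have "atlas A" using assms(3) by (simp add: lie_group_def smooth_manifold_atlas)
  then obtain d0 where "d0 \<in> A" "\<one>\<^bsub>G\<^esub> \<in> fst d0" by (rule atlas_cover)
  then have d0: "d0 \<in> charts_at A \<one>\<^bsub>G\<^esub>" by (simp add: charts_at_def)
  interpret leibniz_lie_group A G d0 p \<iota> ex q \<kappa> by (rule loc[OF d0])
  have "rack_product A r \<one>\<^bsub>G\<^esub> (\<iota> u) (\<iota> v) = \<iota> (p u v)" for u v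
    unfolding rack_product_def
  proof (rule the_equality)
    show "\<iota> (p u v) \<in> tangent_space A \<one>\<^bsub>G\<^esub> \<and>
      (\<forall>\<epsilon>>0. \<forall>c. smooth_map_on vs_atlas A {-\<epsilon><..<\<epsilon>} c \<and> c 0 = \<one>\<^bsub>G\<^esub> \<and> velocity A c 0 = \<iota> v \<longrightarrow>
        (\<forall>d\<in>charts_at A \<one>\<^bsub>G\<^esub>.
          ((\<lambda>t. rack_Ad A r \<one>\<^bsub>G\<^esub> (c t) (\<iota> u) d) has_vector_derivative \<iota> (p u v) d) (at 0)))"
    proof (intro conjI allI impI ballI)
      fix \<epsilon> :: real and c d
      assume "\<epsilon> > 0" and d: "d \<in> charts_at A \<one>\<^bsub>G\<^esub>"
        and c: "smooth_map_on vs_atlas A {-\<epsilon><..<\<epsilon>} c \<and> c 0 = \<one>\<^bsub>G\<^esub> \<and> velocity A c 0 = \<iota> v"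
      show "((\<lambda>t. rack_Ad A r \<one>\<^bsub>G\<^esub> (c t) (\<iota> u) d) has_vector_derivative \<iota> (p u v) d) (at 0)"
        by (rule leibniz_lie_group.rack_Ad_curve_derivative[OF loc[OF d], of "{-\<epsilon><..<\<epsilon>}"])
          (use c \<open>\<epsilon> > 0\<close> in auto)
    qed (rule \<iota>_tangent)
  next
    fix \<zeta>
    assume \<zeta>: "\<zeta> \<in> tangent_space A \<one>\<^bsub>G\<^esub> \<and>
      (\<forall>\<epsilon>>0. \<forall>c. smooth_map_on vs_atlas A {-\<epsilon><..<\<epsilon>} c \<and> c 0 = \<one>\<^bsub>G\<^esub> \<and> velocity A c 0 = \<iota> v \<longrightarrow>
        (\<forall>d\<in>charts_at A \<one>\<^bsub>G\<^esub>.
          ((\<lambda>t. rack_Ad A r \<one>\<^bsub>G\<^esub> (c t) (\<iota> u) d) has_vector_derivative \<zeta> d) (at 0)))"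
    \<comment> \<open>Uniqueness requires at least one admissible path; the one-parameter subgroup
      of \<open>v\<close> has velocity \<open>\<iota> v\<close>.\<close>
    let ?c = "\<lambda>t. ex (t *\<^sub>R v)"
    have c: "smooth_map_on vs_atlas A {-1<..<1} ?c" "?c 0 = \<one>\<^bsub>G\<^esub>" "velocity A ?c 0 = \<iota> v"
      by (simp_all add: smooth_map_on_subset[OF exp_smooth] exp_velocity)
    show "\<zeta> = \<iota> (p u v)"
    proof
      fix d
      show "\<zeta> d = \<iota> (p u v) d"
      proof (cases "d \<in> charts_at A \<one>\<^bsub>G\<^esub>")
        case True
        have "((\<lambda>t. rack_Ad A r \<one>\<^bsub>G\<^esub> (?c t) (\<iota> u) d) has_vector_derivative \<zeta> d) (at 0)"
          using \<zeta> c True zero_less_one by blast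
        moreover have "((\<lambda>t. rack_Ad A r \<one>\<^bsub>G\<^esub> (?c t) (\<iota> u) d) has_vector_derivative \<iota> (p u v) d) (at 0)"
          by (rule leibniz_lie_group.rack_Ad_curve_derivative[OF loc[OF True] c(1) _ _ c(2,3)]) auto
        ultimately show ?thesis by (rule vector_derivative_unique_at)
      next
        case False
        \<comment> \<open>Tangent vectors are normalized to zero at charts not around the identity,
          so equality holds there as well.\<close>
        then have "\<xi> d = 0" if "\<xi> \<in> tangent_space A \<one>\<^bsub>G\<^esub>" for \<xi>
          using that unfolding tangent_space_def by blast
        from this[OF conjunct1[OF \<zeta>]] this[OF \<iota>_tangent] show ?thesis by simp
      qed
    qed
  qed
  with pointed_lie_rack_r show ?thesis by blast
qed

end
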